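(* Let $d\in\mathbb{N}$ and let $X=(X_t)_{t\ge 0}$ be a $d$-dimensional Lévy process whose Lévy triplet $(\Sigma,\nu,\alpha)$ satisfies $\Sigma=0$ and $\int_{\mathbb{R}^d}|x|^4\,\nu(dx)<\infty$; denote the underlying probability measure by $P_{\nu,\alpha}$. Let $w:\mathbb{R}^d\to(0,\infty)$ be continuous and vanishing at infinity, let $\delta_n\downarrow 0$ be a given sequence of positive numbers, and let $(\widehat\nu_n,\widehat\alpha_n)_{n\in\mathbb{N}}$ be minimum distance estimators based on the observations $X_1,\dots,X_n$, as defined in the context. Then, $P_{\nu,\alpha}$-almost surely, the finite Borel measures $|x|^2\,\widehat\nu_n(dx)$ converge weakly to $|x|^2\,\nu(dx)$ as $n\to\infty$, i.e. $P_{\nu,\alpha}$-a.s. $$\int_{\mathbb{R}^d} f(x)|x|^2\,\widehat\nu_n(dx)\to\int_{\mathbb{R}^d} f(x)|x|^2\,\nu(dx)\qquad\text{for all bounded continuous } f \text{ on } \mathbb{R}^d .$$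
   Context: For a Lévy measure $\nu$ on $\mathbb{R}^d$ with $\int|x|^4\nu(dx)<\infty$ and $\alpha\in\mathbb{R}^d$ (and no Brownian part) put $$\varphi_{\nu,\alpha}(u)=\exp\Big(i\langle u,\alpha\rangle+\int_{\mathbb{R}^d}(e^{i\langle u,x\rangle}-1-i\langle u,x\rangle)\,\nu(dx)\Big),\quad u\in\mathbb{R}^d ;$$ under $P_{\nu,\alpha}$ this is the characteristic function of $X_1$. The empirical characteristic function of the increments is $\widehat\varphi_n(u)=\frac1n\sum_{t=1}^n e^{i\langle u,X_t-X_{t-1}\rangle}$ (with $X_0=0$). For $\psi:\mathbb{R}^d\to\mathbb{C}$ let $\|\psi\|_{L^\infty(w)}=\sup_{u\in\mathbb{R}^d}w(u)|\psi(u)|$, and for $\varphi_1,\varphi_2\in\mathcal{C}^2(\mathbb{R}^d)$ let $$d^{(2)}(\varphi_1,\varphi_2)=\|\varphi_1-\varphi_2\|_{L^\infty(w)}+\sum_{k=1}^d\Big\|\tfrac{\partial}{\partial u_k}(\varphi_1-\varphi_2)\Big\|_{L^\infty(w)}+\sum_{k=1}^d\Big\|\tfrac{\partial^2}{\partial u_k^2}(\varphi_1-\varphi_2)\Big\|_{L^\infty(w)} .$$ Minimum distance estimator: for every $n\in\mathbb{N}$ and every $\omega\in\Omega$, $(\widehat\nu_n,\widehat\alpha_n)=(\widehat\nu_n(\omega),\widehat\alpha_n(\omega))$ is any pair consisting of a Lévy measure with $\int|x|^4\,\widehat\nu_n(dx)<\infty$ and a vector $\widehat\alpha_n\in\mathbb{R}^d$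 such that $$d^{(2)}(\widehat\varphi_n,\varphi_{\widehat\nu_n,\widehat\alpha_n})\le\inf_{\nu',\alpha'}d^{(2)}(\widehat\varphi_n,\varphi_{\nu',\alpha'})+\delta_n ,$$ where the infimum runs over all Lévy measures $\nu'$ with $\int|x|^4\nu'(dx)<\infty$ and all $\alpha'\in\mathbb{R}^d$. *)

theory Defs
  imports "HOL-Probability.Probability"
begin

definition levy_measure :: "(real ^ 'd) measure \<Rightarrow> bool" where
  "levy_measure \<nu> \<longleftrightarrow>
     sets \<nu> = sets borel \<and> emeasure \<nu> {0} = 0 \<and>
     (\<integral>\<^sup>+ x. ennreal (min 1 ((norm x)\<^sup>2)) \<partial>\<nu>) < \<infinity>"

definition levy_measure4 :: "(real ^ 'd) measure \<Rightarrow> bool" where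
  "levy_measure4 \<nu> \<longleftrightarrow>
     levy_measure \<nu> \<and> (\<integral>\<^sup>+ x. ennreal ((norm x) ^ 4) \<partial>\<nu>) < \<infinity>"

definition levy_cf :: "(real ^ 'd) measure \<Rightarrow> real ^ 'd \<Rightarrow> real ^ 'd \<Rightarrow> complex" where
  "levy_cf \<nu> \<alpha> u =
     exp (\<i> * complex_of_real (u \<bullet> \<alpha>)
          + (CLINT x|\<nu>. iexp (u \<bullet> x) - 1 - \<i> * complex_of_real (u \<bullet> x)))"

definition levy_process :: "'w measure \<Rightarrow> (real \<Rightarrow> 'w \<Rightarrow> real ^ 'd) \<Rightarrow> bool" where
  "levy_process M X \<longleftrightarrow>
     prob_space M \<and>
     (\<forall>t\<ge>0. X t \<in> borel_measurable M) \<and>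
     (AE \<omega> in M. X 0 \<omega> = 0) \<and>
     (\<forall>(t :: nat \<Rightarrow> real) n. 0 \<le> t 0 \<longrightarrow> (\<forall>i<n. t i < t (Suc i)) \<longrightarrow>
        prob_space.indep_vars M (\<lambda>_. borel) (\<lambda>i \<omega>. X (t (Suc i)) \<omega> - X (t i) \<omega>) {..<n}) \<and>
     (\<forall>s\<ge>0. \<forall>h\<ge>0. distr M borel (\<lambda>\<omega>. X (s + h) \<omega> - X s \<omega>) =
                    distr M borel (\<lambda>\<omega>. X h \<omega> - X 0 \<omega>)) \<and>
     (\<forall>s\<ge>0. \<forall>\<epsilon>>0. ((\<lambda>t. measure M {\<omega> \<in> space M. norm (X t \<omega> - X s \<omega>) > \<epsilon>})
                    \<longlongrightarrow> 0) (at s within {0..})) \<and>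
     (AE \<omega> in M. \<forall>t\<ge>0. continuous (at_right t) (\<lambda>s. X s \<omega>) \<and>
        (t > 0 \<longrightarrow> (\<exists>l. ((\<lambda>s. X s \<omega>) \<longlongrightarrow> l) (at_left t))))"

text \<open>The triplet is the one of the Levy--Khintchine representation without truncation function,
  so \<open>\<alpha>\<close> is the mean of \<open>X 1\<close>. This representation exists only when \<open>X 1\<close> has a finite first
  moment, that is, when \<open>norm\<close> is \<open>\<nu>\<close>-integrable away from the origin.\<close>

definition has_levy_triplet ::
  "'w measure \<Rightarrow> (real \<Rightarrow> 'w \<Rightarrow> real ^ 'd) \<Rightarrow>
   real ^ 'd ^ 'd \<Rightarrow> (real ^ 'd) measure \<Rightarrow> real ^ 'd \<Rightarrow> bool" where
  "has_levy_triplet M X \<Sigma> \<nu> \<alpha> \<longleftrightarrow>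
     transpose \<Sigma> = \<Sigma> \<and> (\<forall>u. 0 \<le> u \<bullet> (\<Sigma> *v u)) \<and>
     levy_measure \<nu> \<and> (\<integral>\<^sup>+ x\<in>{x. norm x > 1}. ennreal (norm x) \<partial>\<nu>) < \<infinity> \<and>
     (\<forall>u. (CLINT \<omega>|M. iexp (u \<bullet> X 1 \<omega>)) =
          exp (complex_of_real (- (u \<bullet> (\<Sigma> *v u)) / 2)) * levy_cf \<nu> \<alpha> u)"

text \<open>The update \<open>x(0 := 0)\<close> encodes the convention \<open>X\<^sub>0 = 0\<close>, so that the function depends on the
  observations \<open>x 1, \<dots>, x n\<close> only.\<close>

definition empirical_cf :: "nat \<Rightarrow> (nat \<Rightarrow> real ^ 'd) \<Rightarrow> real ^ 'd \<Rightarrow> complex" where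
  "empirical_cf n x u =
     (\<Sum>t=1..n. iexp (u \<bullet> ((x(0 := 0)) t - (x(0 := 0)) (t - 1)))) / of_nat n"

definition weighted_sup_norm ::
  "(real ^ 'd \<Rightarrow> real) \<Rightarrow> (real ^ 'd \<Rightarrow> complex) \<Rightarrow> ennreal" where
  "weighted_sup_norm w \<psi> = (SUP u. ennreal (w u * norm (\<psi> u)))"

definition partial_deriv :: "'d \<Rightarrow> (real ^ 'd \<Rightarrow> complex) \<Rightarrow> real ^ 'd \<Rightarrow> complex" where
  "partial_deriv k \<psi> u = vector_derivative (\<lambda>s. \<psi> (u + s *\<^sub>R axis k 1)) (at 0)"

text \<open>Only meaningful for twice continuously differentiable arguments, since \<open>vector_derivative\<close> is
  unspecified where the derivative does not exist.\<close>

definition dist2 ::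
  "(real ^ 'd \<Rightarrow> real) \<Rightarrow> (real ^ 'd \<Rightarrow> complex) \<Rightarrow> (real ^ 'd \<Rightarrow> complex) \<Rightarrow> ennreal" where
  "dist2 w \<phi>1 \<phi>2 =
     (let \<psi> = (\<lambda>u. \<phi>1 u - \<phi>2 u) in
        weighted_sup_norm w \<psi>
        + (\<Sum>k\<in>UNIV. weighted_sup_norm w (partial_deriv k \<psi>))
        + (\<Sum>k\<in>UNIV. weighted_sup_norm w (partial_deriv k (partial_deriv k \<psi>))))"

definition min_distance_estimate ::
  "(real ^ 'd \<Rightarrow> real) \<Rightarrow> real \<Rightarrow> nat \<Rightarrow> (nat \<Rightarrow> real ^ 'd) \<Rightarrow>
   (real ^ 'd) measure \<Rightarrow> real ^ 'd \<Rightarrow> bool" where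
  "min_distance_estimate w \<delta> n x \<nu> \<alpha> \<longleftrightarrow>
     levy_measure4 \<nu> \<and>
     dist2 w (empirical_cf n x) (levy_cf \<nu> \<alpha>)
       \<le> (INF (\<nu>', \<alpha>') \<in> {\<nu>'. levy_measure4 \<nu>'} \<times> UNIV.
             dist2 w (empirical_cf n x) (levy_cf \<nu>' \<alpha>')) + ennreal \<delta>"

end

theory Submission
  imports Defs
begin

text \<open>Since the characteristic function is the exponential of the cumulant function, the fourth moment of
  \<open>\<nu>\<close> gives a fourth moment of the increments. The strong law then applies to \<open>exp (i u \<bullet> x)\<close> times
  \<open>1\<close>, \<open>x $ k\<close> and \<open>(x $ k)\<^sup>2\<close>, locally uniformly in \<open>u\<close>, and as \<open>w\<close> vanishes at infinity the
  empirical characteristic function converges almost surely in the distance \<open>dist2 w\<close>. By minimality so do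
  the characteristic functions of the estimates, in particular pointwise together with their first two
  derivatives. The logarithm of such a characteristic function has the Laplacian
  \<open>u \<mapsto> - \<integral> exp (i u \<bullet> x) |x|\<^sup>2 \<nu>(dx)\<close>, so the Fourier transforms of the finite measures
  \<open>|x|\<^sup>2 \<nu>(dx)\<close> converge, and Levy's continuity theorem yields the weak convergence.\<close>

section \<open>The strong law of large numbers\<close>

text \<open>No logarithm of a characteristic function is taken. If \<phi> = exp \<psi> then \<psi>''
  = \<phi>''/\<phi> - (\<phi>'/\<phi>)^2, so convergence of \<phi>, \<phi>' and \<phi>'' at a point
  gives convergence of \<psi>'' at that point: \<open>levy_cf\<close> has no zeros, and the drift
  disappears with the second derivative. The unmixed second derivatives measured by
  \<open>dist2\<close> suffice, because only their sum matters, in which the (x $ k)^2 add up to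
  |x|^2.

  The hypotheses give the characteristic function of \<open>X 1\<close> but no moments of it. The
  strong law proved here is one for square integrable variables; for the second derivatives it is
  applied to functions of size (x $ k)^2, which is why a fourth moment of the increments has to be
  extracted from the characteristic function.

  Tightness of the measures |x|^2 \<nu>(dx) along the estimates is not assumed either: their total
  masses converge, being the values of the Fourier transforms at 0, and convergence of Gaussian
  integrals keeps mass from escaping to infinity.\<close>

lemma AE_tendsto_0_if_summable_integral:
  fixes U :: "nat \<Rightarrow> 'a \<Rightarrow> real"
  assumes nonneg: "\<And>n x. 0 \<le> U n x" and int: "\<And>n. integrable M (U n)"
    and sum: "summable (\<lambda>n. \<integral>x. U n x \<partial>M)"
  shows "AE x in M. (\<lambda>n. U n x) \<longlonglongrightarrow> 0"
proof -
  have [measurable]: "U n \<in> borel_measurable M" for n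
    using int by auto
  \<comment> \<open>Exchanging sum and integral shows that the series of the \<open>U n x\<close>
    has a finite integral, so it converges almost surely and its terms tend to 0. This plays the
    part of the Borel-Cantelli lemma.\<close>
  have "(\<integral>\<^sup>+x. (\<Sum>n. ennreal (U n x)) \<partial>M) = (\<Sum>n. \<integral>\<^sup>+x. ennreal (U n x) \<partial>M)"
    by (rule nn_integral_suminf) auto
  also have "\<dots> = (\<Sum>n. ennreal (\<integral>x. U n x \<partial>M))"
    by (simp add: nn_integral_eq_integral int nonneg)
  also have "\<dots> < \<infinity>"
    using sum by (subst suminf_ennreal2) (auto intro!: Bochner_Integration.integral_nonneg nonneg)
  finally have "AE x in M. (\<Sum>n. ennreal (U n x)) \<noteq> \<infinity>"
    by (intro nn_integral_PInf_AE) auto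
  then show ?thesis
  proof eventually_elim
    case (elim x)
    then have "summable (\<lambda>n. U n x)"
      by (intro summable_suminf_not_top nonneg) auto
    then show ?case
      by (rule summable_LIMSEQ_zero)
  qed
qed

context prob_space
begin

text \<open>The mixed terms of the expanded square integrate to 0. An arbitrary finite index set is
  allowed because the bound is applied to initial segments as well as to blocks between consecutive
  squares.\<close>

lemma uncorrelated_second_moment_le:
  fixes Z :: "nat \<Rightarrow> 'a \<Rightarrow> real"
  assumes rv: "\<And>i. Z i \<in> borel_measurable M"
    and sq: "\<And>i. integrable M (\<lambda>\<omega>. (Z i \<omega>)\<^sup>2)"
    and bd: "\<And>i. expectation (\<lambda>\<omega>. (Z i \<omega>)\<^sup>2) \<le> C"
    and unc: "\<And>i j. i \<noteq> j \<Longrightarrow> expectation (\<lambda>\<omega>. Z i \<omega> * Z j \<omega>) = 0"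
    and I: "finite I"
  shows "integrable M (\<lambda>\<omega>. (\<Sum>i\<in>I. Z i \<omega>)\<^sup>2)"
    and "expectation (\<lambda>\<omega>. (\<Sum>i\<in>I. Z i \<omega>)\<^sup>2) \<le> C * card I"
proof -
  note [measurable] = rv
  have int: "integrable M (\<lambda>\<omega>. Z i \<omega> * Z j \<omega>)" for i j
  proof (rule Bochner_Integration.integrable_bound)
    show "integrable M (\<lambda>\<omega>. (Z i \<omega>)\<^sup>2 + (Z j \<omega>)\<^sup>2)"
      by (intro Bochner_Integration.integrable_add sq)
    have "\<bar>a * b\<bar> \<le> a\<^sup>2 + b\<^sup>2" for a b :: real
      using sum_squares_bound[of "\<bar>a\<bar>" "\<bar>b\<bar>"] abs_ge_zero[of "a * b"] unfolding abs_mult power2_abs by linarith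
    then show "AE \<omega> in M. norm (Z i \<omega> * Z j \<omega>) \<le> norm ((Z i \<omega>)\<^sup>2 + (Z j \<omega>)\<^sup>2)"
      by simp
  qed simp
  have eq: "(\<Sum>i\<in>I. Z i \<omega>)\<^sup>2 = (\<Sum>i\<in>I. \<Sum>j\<in>I. Z i \<omega> * Z j \<omega>)" for \<omega>
    by (simp add: power2_eq_square sum_product)
  show "integrable M (\<lambda>\<omega>. (\<Sum>i\<in>I. Z i \<omega>)\<^sup>2)"
    unfolding eq by (intro Bochner_Integration.integrable_sum int)
  have "expectation (\<lambda>\<omega>. (\<Sum>i\<in>I. Z i \<omega>)\<^sup>2) = (\<Sum>i\<in>I. \<Sum>j\<in>I. expectation (\<lambda>\<omega>. Z i \<omega> * Z j \<omega>))"
    unfolding eq by (simp add: int)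
  also have "\<dots> = (\<Sum>i\<in>I. \<Sum>j\<in>I. if j = i then expectation (\<lambda>\<omega>. (Z i \<omega>)\<^sup>2) else 0)"
    by (intro sum.cong refl) (auto simp: unc power2_eq_square)
  also have "\<dots> = (\<Sum>i\<in>I. expectation (\<lambda>\<omega>. (Z i \<omega>)\<^sup>2))"
    using I by simp
  also have "\<dots> \<le> C * card I"
    using sum_mono[of I "\<lambda>i. expectation (\<lambda>\<omega>. (Z i \<omega>)\<^sup>2)" "\<lambda>_. C"] bd by (simp add: mult.commute)
  finally show "expectation (\<lambda>\<omega>. (\<Sum>i\<in>I. Z i \<omega>)\<^sup>2) \<le> C * card I" .
qed

text \<open>Rajchman's argument: along the squares \<open>n\<^sup>2\<close> the second moments of the averages are summable, and
  so are those of the increments of the partial sums between consecutive squares.\<close>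

lemma strong_law_uncorrelated:
  fixes Z :: "nat \<Rightarrow> 'a \<Rightarrow> real"
  assumes rv: "\<And>i. Z i \<in> borel_measurable M"
    and sq: "\<And>i. integrable M (\<lambda>\<omega>. (Z i \<omega>)\<^sup>2)"
    and bd: "\<And>i. expectation (\<lambda>\<omega>. (Z i \<omega>)\<^sup>2) \<le> C"
    and unc: "\<And>i j. i \<noteq> j \<Longrightarrow> expectation (\<lambda>\<omega>. Z i \<omega> * Z j \<omega>) = 0"
  shows "AE \<omega> in M. (\<lambda>n. (\<Sum>i<n. Z i \<omega>) / n) \<longlonglongrightarrow> 0"
proof -
  \<comment> \<open>\<open>U n\<close> is the squared average over the first
    \<open>(Suc n)\<^sup>2\<close> terms. \<open>V n\<close> adds the squared block sums over all
    end points in the block; this crude bound for their maximum makes a maximal inequality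
    unnecessary.\<close>
  define U where "U n \<omega> = (\<Sum>i<(Suc n)\<^sup>2. Z i \<omega>)\<^sup>2 / real (Suc n) ^ 4" for n \<omega>
  define J where "J n = {(Suc n)\<^sup>2..<(Suc (Suc n))\<^sup>2}" for n :: nat
  define V where "V n \<omega> = (\<Sum>k\<in>J n. (\<Sum>i\<in>{(Suc n)\<^sup>2..<k}. Z i \<omega>)\<^sup>2) / real (Suc n) ^ 4" for n \<omega>
  note mom = uncorrelated_second_moment_le[OF rv sq bd unc]
  have pow: "D * x\<^sup>2 / x ^ 4 = D / x\<^sup>2" if "x \<noteq> 0" for D x :: real
    using that by (simp add: field_simps eval_nat_numeral)
  have C: "0 \<le> C"
    using order_trans[OF _ bd[of 0]] by (simp add: integral_nonneg)
  have intU: "integrable M (U n)" and intV: "integrable M (V n)" for n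
    unfolding U_def V_def by (auto intro!: mom(1))
  have EU: "expectation (U n) \<le> C / real (Suc n) ^ 2" for n
  proof -
    have "expectation (U n) \<le> C * real (card {..<(Suc n)\<^sup>2}) / real (Suc n) ^ 4"
      unfolding U_def using mom(2)[where I = "{..<(Suc n)\<^sup>2}"] by (simp add: divide_right_mono)
    also have "\<dots> = C / real (Suc n) ^ 2"
      using pow[of "real (Suc n)" C] by (simp del: of_nat_Suc)
    finally show ?thesis .
  qed
  have EV: "expectation (V n) \<le> 9 * C / real (Suc n) ^ 2" for n
  proof -
    \<comment> \<open>The block \<open>J n\<close> has 2 n + 3 \<le> 3 (n + 1) elements. This factor
      enters twice, as the number of end points and as a bound for the length of each partial sum;
      hence the 9.\<close>
    have cJ: "(Suc (Suc n))\<^sup>2 - (Suc n)\<^sup>2 \<le> 3 * Suc n"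
      by (simp add: power2_eq_square)
    have "expectation (V n) =
        (\<Sum>k\<in>J n. expectation (\<lambda>\<omega>. (\<Sum>i\<in>{(Suc n)\<^sup>2..<k}. Z i \<omega>)\<^sup>2)) / real (Suc n) ^ 4"
      unfolding V_def by (simp add: mom(1))
    also have "\<dots> \<le> (\<Sum>k\<in>J n. C * real (3 * Suc n)) / real (Suc n) ^ 4"
    proof (intro divide_right_mono sum_mono)
      fix k assume "k \<in> J n"
      then have "k - (Suc n)\<^sup>2 \<le> 3 * Suc n"
        using cJ unfolding J_def atLeastLessThan_iff by linarith
      then have "C * real (card {(Suc n)\<^sup>2..<k}) \<le> C * real (3 * Suc n)"
        using C by (intro mult_left_mono) (simp_all only: card_atLeastLessThan of_nat_le_iff)
      with mom(2)[where I = "{(Suc n)\<^sup>2..<k}"]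
      show "expectation (\<lambda>\<omega>. (\<Sum>i\<in>{(Suc n)\<^sup>2..<k}. Z i \<omega>)\<^sup>2) \<le> C * real (3 * Suc n)"
        by fastforce
    qed simp
    also have "\<dots> \<le> (real (3 * Suc n) * (C * real (3 * Suc n))) / real (Suc n) ^ 4"
    proof -
      have "real (card (J n)) \<le> real (3 * Suc n)"
        using cJ unfolding J_def by (simp only: card_atLeastLessThan of_nat_le_iff)
      then show ?thesis
        unfolding sum_constant using C by (intro divide_right_mono mult_right_mono) auto
    qed
    also have "\<dots> = 9 * C / real (Suc n) ^ 2"
      using pow[of "real (Suc n)" "9 * C"]
      unfolding power2_eq_square of_nat_mult by (simp add: mult_ac del: of_nat_Suc)
    finally show ?thesis .
  qed
  have sm: "summable (\<lambda>n. D / real (Suc n) ^ 2)" for D :: real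
    using summable_mult[OF inverse_squares_sums[THEN sums_summable], of D] by (simp add: divide_inverse add.commute)
  have nonneg: "0 \<le> U n \<omega>" "0 \<le> V n \<omega>" for n \<omega>
    by (auto simp: U_def V_def intro!: sum_nonneg divide_nonneg_nonneg)
  have "AE \<omega> in M. (\<lambda>n. U n \<omega>) \<longlonglongrightarrow> 0"
    using EU nonneg(1) by (intro AE_tendsto_0_if_summable_integral intU summable_comparison_test[OF _ sm[of C]])
      auto
  moreover have "AE \<omega> in M. (\<lambda>n. V n \<omega>) \<longlonglongrightarrow> 0"
    using EV nonneg(2) by (intro AE_tendsto_0_if_summable_integral intV summable_comparison_test[OF _ sm[of "9 * C"]])
      auto
  ultimately show ?thesis
  proof eventually_elim
    case (elim \<omega>)
    \<comment> \<open>For N \<ge> 1, \<open>Suc (q N)\<close> is the integer square root of N; the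
      subtraction undoes the \<open>Suc\<close> in \<open>U\<close> and \<open>V\<close>.\<close>
    define q where "q N = floor_sqrt N - 1" for N
    have le: "norm ((\<Sum>i<N. Z i \<omega>) / N) \<le> sqrt (U (q N) \<omega>) + sqrt (V (q N) \<omega>)" if "1 \<le> N" for N
    proof -
      define n where "n = q N"
      have N: "(Suc n)\<^sup>2 \<le> N" "N < (Suc (Suc n))\<^sup>2"
        using that floor_sqrt_power2_le[of N] Suc_floor_sqrt_power2_gt[of N]
          floor_sqrt_greater_zero_iff[of N]
        by (auto simp: n_def q_def simp del: power_Suc)
      have "(\<Sum>i<N. Z i \<omega>) = (\<Sum>i<(Suc n)\<^sup>2. Z i \<omega>) + (\<Sum>i\<in>{(Suc n)\<^sup>2..<N}. Z i \<omega>)"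
        using N by (metis lessThan_atLeast0 sum.atLeastLessThan_concat zero_le)
      then have "\<bar>(\<Sum>i<N. Z i \<omega>) / N\<bar> \<le> (\<bar>\<Sum>i<(Suc n)\<^sup>2. Z i \<omega>\<bar> + \<bar>\<Sum>i\<in>{(Suc n)\<^sup>2..<N}. Z i \<omega>\<bar>) / N"
        by (simp add: divide_right_mono del: power_Suc)
      also have "\<dots> \<le> (\<bar>\<Sum>i<(Suc n)\<^sup>2. Z i \<omega>\<bar> + \<bar>\<Sum>i\<in>{(Suc n)\<^sup>2..<N}. Z i \<omega>\<bar>) / (real (Suc n))\<^sup>2"
      proof (rule divide_left_mono)
        show "(real (Suc n))\<^sup>2 \<le> real N"
          using N(1) by (metis of_nat_le_iff of_nat_power)
        then show "0 < real N * (real (Suc n))\<^sup>2"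
          using that by simp
      qed simp
      also have "\<dots> = sqrt (U n \<omega>) + sqrt ((\<Sum>i\<in>{(Suc n)\<^sup>2..<N}. Z i \<omega>)\<^sup>2 / real (Suc n) ^ 4)"
      proof -
        have "sqrt (real (Suc n) ^ 4) = (real (Suc n))\<^sup>2"
          by (rule real_sqrt_unique) (auto simp: eval_nat_numeral)
        then show ?thesis
          unfolding U_def real_sqrt_divide real_sqrt_abs by (simp add: add_divide_distrib)
      qed
      also have "\<dots> \<le> sqrt (U n \<omega>) + sqrt (V n \<omega>)"
      proof -
        have "(\<Sum>i\<in>{(Suc n)\<^sup>2..<N}. Z i \<omega>)\<^sup>2 \<le> (\<Sum>k\<in>J n. (\<Sum>i\<in>{(Suc n)\<^sup>2..<k}. Z i \<omega>)\<^sup>2)"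
          by (rule member_le_sum) (use N in \<open>auto simp only: J_def atLeastLessThan_iff zero_le_power2 finite_atLeastLessThan\<close>)
        then show ?thesis
          unfolding V_def by (intro add_left_mono real_sqrt_le_mono divide_right_mono) simp_all
      qed
      finally show ?thesis
        by (simp add: n_def)
    qed
    have "filterlim floor_sqrt at_top sequentially"
      unfolding filterlim_at_top
    proof
      fix K :: nat
      show "eventually (\<lambda>N. K \<le> floor_sqrt N) sequentially"
        using eventually_ge_at_top[of "K\<^sup>2"] by eventually_elim (simp add: le_floor_sqrtI)
    qed
    then have q: "filterlim q at_top sequentially"
      unfolding q_def by (rule filterlim_compose[OF filterlim_minus_const_nat_at_top])
    show ?case
    proof (rule Lim_null_comparison)
      show "eventually (\<lambda>N. norm ((\<Sum>i<N. Z i \<omega>) / N) \<le> sqrt (U (q N) \<omega>) + sqrt (V (q N) \<omega>)) sequentially"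
        using eventually_ge_at_top[of 1] by eventually_elim (rule le)
      have "(\<lambda>N. sqrt (U (q N) \<omega>) + sqrt (V (q N) \<omega>)) \<longlonglongrightarrow> sqrt 0 + sqrt 0"
        by (intro tendsto_add tendsto_real_sqrt filterlim_compose[OF elim(1) q] filterlim_compose[OF elim(2) q])
      then show "(\<lambda>N. sqrt (U (q N) \<omega>) + sqrt (V (q N) \<omega>)) \<longlonglongrightarrow> 0"
        by simp
    qed
  qed
qed

text \<open>Centring makes the variables uncorrelated with a common second moment, so
  \<open>strong_law_uncorrelated\<close> applies. The second moment asked for here becomes a fourth
  moment of the increments when \<open>g\<close> is quadratic.\<close>

lemma strong_law_iid:
  fixes Y :: "nat \<Rightarrow> 'a \<Rightarrow> 'b::topological_space" and g :: "'b \<Rightarrow> real"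
  assumes indep: "\<And>n. indep_vars (\<lambda>_. borel) Y {..<n}"
    and distr: "\<And>i. distr M borel (Y i) = P"
    and g[measurable]: "g \<in> borel_measurable borel" and sq: "integrable P (\<lambda>y. (g y)\<^sup>2)"
  shows "AE \<omega> in M. (\<lambda>n. (\<Sum>i<n. g (Y i \<omega>)) / n) \<longlonglongrightarrow> (\<integral>y. g y \<partial>P)"
proof -
  have rv[measurable]: "Y i \<in> borel_measurable M" for i
    using indep[of "Suc i"] by (auto simp: indep_vars_def)
  have P: "prob_space P"
    unfolding distr[of 0, symmetric] by (rule prob_space_distr) simp
  then interpret P: prob_space P .
  have sets_P[measurable_cong]: "sets P = sets borel"
    unfolding distr[of 0, symmetric] by simp
  have gi: "integrable P g"
    by (rule P.square_integrable_imp_integrable[OF _ sq]) simp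
  define m where "m = (\<integral>y. g y \<partial>P)"
  have int_Y: "integrable M (\<lambda>\<omega>. f (Y i \<omega>)) \<longleftrightarrow> integrable P f"
    if [measurable]: "f \<in> borel_measurable borel" for f :: "'b \<Rightarrow> real" and i
    unfolding distr[of i, symmetric] by (rule integrable_distr_eq[symmetric]) simp_all
  have E_Y: "expectation (\<lambda>\<omega>. f (Y i \<omega>)) = (\<integral>y. f y \<partial>P)"
    if [measurable]: "f \<in> borel_measurable borel" for f :: "'b \<Rightarrow> real" and i
    unfolding distr[of i, symmetric] by (rule integral_distr[symmetric]) simp_all
  have sq': "integrable P (\<lambda>y. (g y - m)\<^sup>2)"
    unfolding power2_diff using sq gi by auto
  have "AE \<omega> in M. (\<lambda>n. (\<Sum>i<n. g (Y i \<omega>) - m) / n) \<longlonglongrightarrow> 0"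
  proof (rule strong_law_uncorrelated)
    show "integrable M (\<lambda>\<omega>. (g (Y i \<omega>) - m)\<^sup>2)" for i
      using sq' by (subst int_Y) auto
    show "expectation (\<lambda>\<omega>. (g (Y i \<omega>) - m)\<^sup>2) \<le> (\<integral>y. (g y - m)\<^sup>2 \<partial>P)" for i
      by (subst E_Y) auto
    have E0: "expectation (\<lambda>\<omega>. g (Y k \<omega>) - m) = 0" for k
      using gi by (subst E_Y) (auto simp: m_def P.prob_space)
    fix i j :: nat assume ij: "i \<noteq> j"
    have "indep_vars (\<lambda>_. borel) (\<lambda>i \<omega>. g (Y i \<omega>) - m) {i, j}"
      by (rule indep_vars_compose2[OF indep_vars_subset[OF indep[of "Suc (max i j)"]]]) auto
    then have "expectation (\<lambda>\<omega>. \<Prod>k\<in>{i, j}. g (Y k \<omega>) - m) = (\<Prod>k\<in>{i, j}. expectation (\<lambda>\<omega>. g (Y k \<omega>) - m))"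
      using gi by (intro indep_vars_lebesgue_integral) (auto simp: int_Y)
    then show "expectation (\<lambda>\<omega>. (g (Y i \<omega>) - m) * (g (Y j \<omega>) - m)) = 0"
      using ij by (simp add: E0)
  qed simp
  then show ?thesis
  proof eventually_elim
    case (elim \<omega>)
    have "(\<lambda>n. (\<Sum>i<n. g (Y i \<omega>) - m) / n + m) \<longlonglongrightarrow> 0 + m"
      by (intro tendsto_add elim tendsto_const)
    moreover have "eventually (\<lambda>n. (\<Sum>i<n. g (Y i \<omega>) - m) / n + m = (\<Sum>i<n. g (Y i \<omega>)) / n) sequentially"
      using eventually_gt_at_top[of 0]
      by eventually_elim (simp add: sum_subtractf field_simps)
    ultimately show ?case
      unfolding m_def by (simp add: tendsto_cong)
  qed
qed

lemma strong_law_iid_complex: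
  fixes Y :: "nat \<Rightarrow> 'a \<Rightarrow> 'b::topological_space" and g :: "'b \<Rightarrow> complex"
  assumes indep: "\<And>n. indep_vars (\<lambda>_. borel) Y {..<n}"
    and distr: "\<And>i. distr M borel (Y i) = P"
    and g[measurable]: "g \<in> borel_measurable borel" and sq: "integrable P (\<lambda>y. (norm (g y))\<^sup>2)"
  shows "AE \<omega> in M. (\<lambda>n. (\<Sum>i<n. g (Y i \<omega>)) / n) \<longlonglongrightarrow> (\<integral>y. g y \<partial>P)"
proof -
  have rv[measurable]: "Y i \<in> borel_measurable M" for i
    using indep[of "Suc i"] by (auto simp: indep_vars_def)
  interpret P: prob_space P
    unfolding distr[of 0, symmetric] by (rule prob_space_distr) simp
  have sets_P[measurable_cong]: "sets P = sets borel"
    unfolding distr[of 0, symmetric] by simp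
  have "integrable P (\<lambda>y. norm (g y))"
    by (rule P.square_integrable_imp_integrable[OF _ sq]) simp
  then have gi: "integrable P g"
    by (simp add: integrable_norm_iff)
  have le: "(Re z)\<^sup>2 \<le> (norm z)\<^sup>2" "(Im z)\<^sup>2 \<le> (norm z)\<^sup>2" for z
    by (simp_all add: cmod_power2)
  have "AE \<omega> in M. (\<lambda>n. (\<Sum>i<n. Re (g (Y i \<omega>))) / n) \<longlonglongrightarrow> (\<integral>y. Re (g y) \<partial>P)"
    using le by (intro strong_law_iid[OF indep distr] Bochner_Integration.integrable_bound[OF sq]) auto
  moreover have "AE \<omega> in M. (\<lambda>n. (\<Sum>i<n. Im (g (Y i \<omega>))) / n) \<longlonglongrightarrow> (\<integral>y. Im (g y) \<partial>P)"
    using le by (intro strong_law_iid[OF indep distr] Bochner_Integration.integrable_bound[OF sq]) auto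
  ultimately show ?thesis
    by eventually_elim (simp add: tendsto_complex_iff gi)
qed

text \<open>One null set serves all frequencies of a countable dense set \<open>D\<close>. Between
  neighbouring frequencies the oscillation is controlled by averages of the majorants
  \<open>g m\<close>, which obey the strong law themselves, so finitely many centres in
  \<open>D\<close> settle a compact ball. Outside the ball only boundedness is left, and there the
  small weight takes over; without a weight, uniformity over all frequencies fails in
  general.\<close>

lemma weighted_uniform_strong_law:
  fixes Y :: "nat \<Rightarrow> 'a \<Rightarrow> 'b::euclidean_space" and h :: "'b \<Rightarrow> complex"
  assumes indep: "\<And>n. indep_vars (\<lambda>_. borel) Y {..<n}"
    and distr: "\<And>i. distr M borel (Y i) = P"
    and h[measurable]: "h \<in> borel_measurable borel" and sq: "integrable P (\<lambda>y. (norm (h y))\<^sup>2)"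
    and w: "continuous_on UNIV w" "(w \<longlongrightarrow> 0) at_infinity" "\<And>u. 0 \<le> w u"
  shows "AE \<omega> in M. \<forall>e>0. \<forall>\<^sub>F n in sequentially. \<forall>u.
    w u * norm ((\<Sum>i<n. h (Y i \<omega>) * iexp (u \<bullet> Y i \<omega>)) / n - (\<integral>y. h y * iexp (u \<bullet> y) \<partial>P)) \<le> e"
proof -
  have rv[measurable]: "Y i \<in> borel_measurable M" for i
    using indep[of "Suc i"] by (auto simp: indep_vars_def)
  interpret P: prob_space P
    unfolding distr[of 0, symmetric] by (rule prob_space_distr) simp
  have sets_P[measurable_cong]: "sets P = sets borel"
    unfolding distr[of 0, symmetric] by simp
  have hi: "integrable P (\<lambda>y. norm (h y))"
    by (rule P.square_integrable_imp_integrable[OF _ sq]) simp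
  have hei: "integrable P (\<lambda>y. h y * iexp (u \<bullet> y))" for u
    by (rule Bochner_Integration.integrable_bound[OF hi]) (auto simp: norm_mult)
  obtain D :: "'b set" where D: "countable D" "\<And>X. open X \<Longrightarrow> X \<noteq> {} \<Longrightarrow> \<exists>d\<in>D. d \<in> X"
    using countable_dense_setE by blast
  \<comment> \<open>A bound for the oscillation of u \<mapsto> h y * exp (i u \<bullet> y) over
    distances up to 1 / (m + 1). The minimum with 2 keeps it below 2 |h y|, so that it is square
    integrable whenever \<open>h\<close> is, and dominated convergence makes its mean small for
    large m.\<close>
  define g where "g m y = norm (h y) * min 2 (norm y / real (Suc m))" for m :: nat and y :: 'b
  have g_meas[measurable]: "g m \<in> borel_measurable borel" for m
    unfolding g_def by measurable
  have g_nonneg: "0 \<le> g m y" and g_le: "g m y \<le> 2 * norm (h y)" for m y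
    unfolding g_def using mult_left_mono[of "min 2 (norm y / real (Suc m))" 2 "norm (h y)"]
    by (simp_all add: mult.commute)
  have gi: "integrable P (g m)" for m
    by (rule Bochner_Integration.integrable_bound[OF integrable_mult_right[OF hi, of 2]])
      (use g_nonneg g_le in auto)
  have g_sq: "integrable P (\<lambda>y. (g m y)\<^sup>2)" for m
  proof (rule Bochner_Integration.integrable_bound[OF integrable_mult_right[OF sq, of 4]])
    have "(g m y)\<^sup>2 \<le> (2 * norm (h y))\<^sup>2" for y
      by (intro power_mono g_le g_nonneg)
    then show "AE y in P. norm ((g m y)\<^sup>2) \<le> norm (4 * (norm (h y))\<^sup>2)"
      by (simp add: power_mult_distrib)
  qed simp
  have g_lim: "(\<lambda>m. \<integral>y. g m y \<partial>P) \<longlonglongrightarrow> 0"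
  proof -
    have "(\<lambda>m. \<integral>y. g m y \<partial>P) \<longlonglongrightarrow> (\<integral>y. 0 \<partial>P)"
    proof (rule integral_dominated_convergence)
      show "integrable P (\<lambda>y. 2 * norm (h y))"
        using hi by simp
      have "(\<lambda>m. norm (h y) * min 2 (norm y / real (Suc m))) \<longlonglongrightarrow> norm (h y) * min 2 0" for y
        by (intro tendsto_mult tendsto_const tendsto_min
            filterlim_compose[OF lim_const_over_n[of "norm y"] filterlim_Suc])
      then show "AE y in P. (\<lambda>m. g m y) \<longlonglongrightarrow> 0"
        unfolding g_def by simp
    qed (use g_nonneg g_le in auto)
    then show ?thesis by simp
  qed
  have lip: "norm (h y * iexp (u \<bullet> y) - h y * iexp (v \<bullet> y)) \<le> g m y" if "dist u v \<le> 1 / real (Suc m)" for u v y m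
  proof -
    have 1: "norm (iexp (u \<bullet> y) - iexp (v \<bullet> y)) \<le> 2"
      using norm_triangle_ineq4[of "iexp (u \<bullet> y)" "iexp (v \<bullet> y)"] by simp
    have "iexp (u \<bullet> y) - iexp (v \<bullet> y) = iexp (v \<bullet> y) * (iexp ((u - v) \<bullet> y) - 1)"
      by (simp add: inner_diff_left exp_diff right_diff_distrib)
    then have "norm (iexp (u \<bullet> y) - iexp (v \<bullet> y)) = norm (iexp ((u - v) \<bullet> y) - 1)"
      by (simp add: norm_mult)
    also have "\<dots> \<le> \<bar>(u - v) \<bullet> y\<bar>"
      using iexp_approx1[of "(u - v) \<bullet> y" 0] by simp
    also have "\<dots> \<le> norm (u - v) * norm y"
      by (rule Cauchy_Schwarz_ineq2)
    also have "\<dots> \<le> norm y / real (Suc m)"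
      using mult_right_mono[OF that, of "norm y"] by (simp add: dist_norm)
    finally show ?thesis
      using 1 unfolding g_def right_diff_distrib[symmetric] norm_mult by (intro mult_left_mono) auto
  qed
  obtain W where W: "\<And>u. w u \<le> W" "0 < W"
  proof -
    obtain R where R: "\<And>u. R \<le> norm u \<Longrightarrow> w u < 1"
      using order_tendstoD(2)[OF w(2), of 1] unfolding eventually_at_infinity by auto
    have "compact (w ` cball 0 R)"
      by (intro compact_continuous_image continuous_on_subset[OF w(1)]) auto
    then obtain B where B: "\<And>u. u \<in> cball 0 R \<Longrightarrow> norm (w u) \<le> B"
      by (meson bounded_iff compact_imp_bounded image_eqI)
    have "w u \<le> max 1 B" for u
      using R[of u] B[of u] by (cases "R \<le> norm u") auto
    then show ?thesis
      by (intro that[of "max 1 B"]) auto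
  qed
  define E where "E u = (\<integral>y. h y * iexp (u \<bullet> y) \<partial>P)" for u
  have "AE \<omega> in M. \<forall>c\<in>D. (\<lambda>n. (\<Sum>i<n. h (Y i \<omega>) * iexp (c \<bullet> Y i \<omega>)) / n) \<longlonglongrightarrow> E c"
    unfolding AE_ball_countable[OF D(1)] E_def using sq
    by (intro ballI strong_law_iid_complex[OF indep distr]) (auto simp: norm_mult)
  moreover have "AE \<omega> in M. \<forall>m. (\<lambda>n. (\<Sum>i<n. g m (Y i \<omega>)) / n) \<longlonglongrightarrow> (\<integral>y. g m y \<partial>P)"
    unfolding AE_all_countable by (intro allI strong_law_iid[OF indep distr] g_sq) simp
  moreover have "AE \<omega> in M. (\<lambda>n. (\<Sum>i<n. norm (h (Y i \<omega>))) / n) \<longlonglongrightarrow> (\<integral>y. norm (h y) \<partial>P)"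
    by (intro strong_law_iid[OF indep distr] sq) simp
  ultimately show ?thesis
  proof eventually_elim
    case (elim \<omega>)
    define A where "A n u = (\<Sum>i<n. h (Y i \<omega>) * iexp (u \<bullet> Y i \<omega>)) / n" for n :: nat and u
    define G where "G m n = (\<Sum>i<n. g m (Y i \<omega>)) / n" for m n :: nat
    define H where "H = (\<integral>y. norm (h y) \<partial>P)"
    have H: "0 \<le> H"
      unfolding H_def by simp
    \<comment> \<open>Since the exponential has modulus 1, the averages are eventually at most H + 1
      and the limit is at most H in norm, whatever the frequency.\<close>
    have bound: "eventually (\<lambda>n. \<forall>u. norm (A n u - E u) \<le> 2 * H + 1) sequentially"
    proof -
      have "eventually (\<lambda>n. (\<Sum>i<n. norm (h (Y i \<omega>))) / n < H + 1) sequentially"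
        using order_tendstoD(2)[OF elim(3), of "H + 1"] by (simp add: H_def)
      then show ?thesis
      proof eventually_elim
        case (elim n)
        show ?case
        proof
          fix u
          have "norm (A n u) \<le> (\<Sum>i<n. norm (h (Y i \<omega>))) / n"
            unfolding A_def norm_divide
            using norm_sum[of "\<lambda>i. h (Y i \<omega>) * iexp (u \<bullet> Y i \<omega>)" "{..<n}"]
            by (simp add: norm_mult divide_right_mono)
          moreover have "norm (E u) \<le> H"
            unfolding E_def H_def using integral_norm_bound[of P "\<lambda>y. h y * iexp (u \<bullet> y)"] by (simp add: norm_mult)
          ultimately show "norm (A n u - E u) \<le> 2 * H + 1"
            using elim norm_triangle_ineq4[of "A n u" "E u"] by linarith
        qed
      qed
    qed
    have osc: "norm (A n u - A n v) \<le> G m n" "norm (E u - E v) \<le> (\<integral>y. g m y \<partial>P)"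
      if "dist u v \<le> 1 / real (Suc m)" for u v m n
    proof -
      have "norm (\<Sum>i<n. h (Y i \<omega>) * iexp (u \<bullet> Y i \<omega>) - h (Y i \<omega>) * iexp (v \<bullet> Y i \<omega>)) \<le> (\<Sum>i<n. g m (Y i \<omega>))"
        by (intro sum_norm_le lip that)
      then show "norm (A n u - A n v) \<le> G m n"
        unfolding A_def G_def diff_divide_distrib[symmetric] sum_subtractf[symmetric] norm_divide
        by (simp add: divide_right_mono)
      have "E u - E v = (\<integral>y. h y * iexp (u \<bullet> y) - h y * iexp (v \<bullet> y) \<partial>P)"
        unfolding E_def using hei by simp
      also have "norm \<dots> \<le> (\<integral>y. norm (h y * iexp (u \<bullet> y) - h y * iexp (v \<bullet> y)) \<partial>P)"
        by (rule integral_norm_bound)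
      also have "\<dots> \<le> (\<integral>y. g m y \<partial>P)"
        using hei by (intro integral_mono gi lip that) auto
      finally show "norm (E u - E v) \<le> (\<integral>y. g m y \<partial>P)" .
    qed
    have "\<forall>\<^sub>F n in sequentially. \<forall>u. w u * norm (A n u - E u) \<le> e" if e: "0 < e" for e
    proof -
      \<comment> \<open>Three errors below \<open>d\<close> will be added, so 4 leaves slack; the
        division by \<open>W\<close> absorbs the weight on the compact ball.\<close>
      define d where "d = e / (4 * W)"
      have d: "0 < d"
        using e W by (simp add: d_def)
      obtain R where R: "\<And>u. R \<le> norm u \<Longrightarrow> w u < e / (2 * H + 1)"
        using order_tendstoD(2)[OF w(2), of "e / (2 * H + 1)"] e H unfolding eventually_at_infinity by auto
      obtain m where m: "(\<integral>y. g m y \<partial>P) < d"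
        using order_tendstoD(2)[OF g_lim d] by (auto simp: eventually_sequentially)
      have "cball 0 R \<subseteq> (\<Union>c\<in>D. ball c (1 / real (Suc m)))"
      proof
        fix u :: 'b
        obtain c where "c \<in> D" "c \<in> ball u (1 / real (Suc m))"
          using D(2)[of "ball u (1 / real (Suc m))"] by auto
        then show "u \<in> (\<Union>c\<in>D. ball c (1 / real (Suc m)))"
          by (auto simp: dist_commute)
      qed
      then obtain C where C: "C \<subseteq> D" "finite C" "cball 0 R \<subseteq> (\<Union>c\<in>C. ball c (1 / real (Suc m)))"
        using compactE_image[OF compact_cball, of D "\<lambda>c. ball c (1 / real (Suc m))" 0 R] by auto
      have "eventually (\<lambda>n. \<forall>c\<in>C. dist (A n c) (E c) < d) sequentially"
        unfolding eventually_ball_finite_distrib[OF C(2)]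
        using elim(1) C(1) d by (auto simp: A_def intro!: tendstoD)
      moreover have "eventually (\<lambda>n. G m n < d) sequentially"
        using order_tendstoD(2)[OF elim(2)[rule_format] m] by (simp add: G_def)
      ultimately show ?thesis
        using bound
      proof eventually_elim
        case (elim n)
        show ?case
        proof
          fix u
          show "w u * norm (A n u - E u) \<le> e"
          proof (cases "R \<le> norm u")
            case True
            have "w u * norm (A n u - E u) \<le> (e / (2 * H + 1)) * (2 * H + 1)"
              using R[OF True] elim(3) w(3)[of u] H by (intro mult_mono) auto
            then show ?thesis using H by simp
          next
            case False
            then obtain c where c: "c \<in> C" "dist u c \<le> 1 / real (Suc m)"
              using subsetD[OF C(3), of u] by (auto simp: dist_commute less_imp_le)
            have "norm (A n u - E u) \<le> norm (A n u - A n c) + norm (A n c - E c) + norm (E u - E c)"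
              by norm
            also have "\<dots> \<le> 4 * d"
              using osc(1)[OF c(2), of n] osc(2)[OF c(2)] elim(1)[rule_format, OF c(1)] elim(2) m d
              unfolding dist_norm by linarith
            finally have "w u * norm (A n u - E u) \<le> W * (4 * d)"
              using W w(3)[of u] by (intro mult_mono) auto
            then show ?thesis
              using W by (simp add: d_def)
          qed
        qed
      qed
    qed
    then show ?case
      unfolding A_def E_def by blast
  qed
qed

end

section \<open>Levy's continuity theorem for finite measures\<close>

text \<open>The free phase \<open>b\<close> makes a single generator enough: it yields sines, and
  constants at u = 0. Real values are used so that the real Stone-Weierstrass theorem and truncation
  at a fixed level are available.\<close>

inductive trig_poly :: "('b::real_inner \<Rightarrow> real) \<Rightarrow> bool" where
  cos: "trig_poly (\<lambda>x. c * cos (u \<bullet> x + b))"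
| add: "trig_poly p \<Longrightarrow> trig_poly q \<Longrightarrow> trig_poly (\<lambda>x. p x + q x)"

lemma trig_poly_const: "trig_poly (\<lambda>_. c)"
  using trig_poly.cos[of c 0 0] by simp

lemma trig_poly_cos_mult:
  assumes "trig_poly q"
  shows "trig_poly (\<lambda>x. c * cos (u \<bullet> x + b) * q x)"
  using assms
proof induction
  case (cos c' u' b')
  have "(\<lambda>x. c * cos (u \<bullet> x + b) * (c' * cos (u' \<bullet> x + b'))) =
    (\<lambda>x. (c * c' / 2) * cos ((u - u') \<bullet> x + (b - b')) + (c * c' / 2) * cos ((u + u') \<bullet> x + (b + b')))"
    using cos_times_cos[of "u \<bullet> x + b" "u' \<bullet> x + b'" for x]
    by (auto simp: fun_eq_iff inner_diff_left inner_add_left algebra_simps add_divide_distrib)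
  then show ?case
    by (simp only: trig_poly.intros)
next
  case (add p q)
  then show ?case
    using trig_poly.add[OF add.IH] by (simp add: algebra_simps)
qed

lemma trig_poly_mult:
  assumes "trig_poly p" "trig_poly q"
  shows "trig_poly (\<lambda>x. p x * q x)"
  using assms(1)
proof induction
  case (add p1 p2)
  then show ?case
    using trig_poly.add[OF add.IH] by (simp add: algebra_simps)
qed (rule trig_poly_cos_mult[OF assms(2)])

lemma continuous_on_trig_poly: "trig_poly p \<Longrightarrow> continuous_on S p"
  by (induction rule: trig_poly.induct) (auto intro!: continuous_intros)

lemma bounded_trig_poly: "trig_poly p \<Longrightarrow> \<exists>B. \<forall>x. \<bar>p x\<bar> \<le> B"
proof (induction rule: trig_poly.induct)
  case (cos c u b)
  have "\<bar>c * cos (u \<bullet> x + b)\<bar> \<le> \<bar>c\<bar> * 1" for x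
    unfolding abs_mult by (intro mult_left_mono) auto
  then show ?case by blast
next
  case (add p q)
  then obtain B C where "\<And>x. \<bar>p x\<bar> \<le> B" "\<And>x. \<bar>q x\<bar> \<le> C" by blast
  then have "\<bar>p x + q x\<bar> \<le> B + C" for x
    using abs_triangle_ineq[of "p x" "q x"] by (meson add_mono order_trans)
  then show ?case by blast
qed

lemma trig_poly_compose:
  assumes "real_polynomial_function (q :: real \<Rightarrow> real)" "trig_poly p"
  shows "trig_poly (\<lambda>x. q (p x))"
  using assms(1)
proof induction
  case (linear f)
  have "f (p x) = f 1 * p x" for x
    using linear_scale[OF bounded_linear.linear[OF linear], of "p x" 1] by (simp add: mult.commute)
  then have eq: "(\<lambda>x. f (p x)) = (\<lambda>x. f 1 * p x)"
    by (rule ext)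
  show ?case
    unfolding eq by (intro trig_poly_mult trig_poly_const assms)
qed (rule trig_poly_const trig_poly.add trig_poly_mult; assumption)+

text \<open>Composing a trigonometric approximant with a polynomial close to the truncation at \<open>\<plusminus> F\<close> keeps
  it bounded by \<open>F + e\<close> outside the compact set as well.\<close>

lemma trig_poly_approx:
  fixes f :: "'b::euclidean_space \<Rightarrow> real"
  assumes f: "continuous_on UNIV f" "\<And>x. \<bar>f x\<bar> \<le> F" and K: "compact K" and e: "0 < e"
  obtains p where "trig_poly p" "\<And>x. x \<in> K \<Longrightarrow> \<bar>f x - p x\<bar> < e" "\<And>x. \<bar>p x\<bar> \<le> F + e"
proof -
  have "\<exists>p. trig_poly p \<and> (\<forall>x\<in>K. \<bar>f x - p x\<bar> < e / 2)"
  proof (rule Stone_Weierstrass_HOL[OF K])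
    fix x y :: 'b assume "x \<in> K \<and> y \<in> K \<and> x \<noteq> y"
    then have xy: "x \<noteq> y" by simp
    \<comment> \<open>Scaled so that the argument of the cosine below is 1 at \<open>x\<close> and 0
      at \<open>y\<close>; since cos 1 < cos 0, this generator separates the two points.\<close>
    define z where "z = (inverse ((x - y) \<bullet> (x - y))) *\<^sub>R (x - y)"
    have "z \<bullet> x = z \<bullet> y + 1"
    proof -
      have "z \<bullet> (x - y) = 1"
        using xy by (simp add: z_def)
      then show ?thesis by (simp add: inner_diff_right)
    qed
    then have "1 * cos (z \<bullet> x + (- (z \<bullet> y))) \<noteq> 1 * cos (z \<bullet> y + (- (z \<bullet> y)))"
      using cos_monotone_0_pi[of 0 1] pi_ge_two by simp
    then show "\<exists>p. trig_poly p \<and> p x \<noteq> p y"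
      using trig_poly.cos[of 1 z "- (z \<bullet> y)"] by blast
  next
    show "continuous_on K f"
      by (rule continuous_on_subset[OF f(1)]) simp
    show "0 < e / 2"
      using e by simp
  qed (blast intro: trig_poly.add trig_poly_mult trig_poly_const continuous_on_trig_poly)+
  then obtain p where p: "trig_poly p" "\<And>x. x \<in> K \<Longrightarrow> \<bar>f x - p x\<bar> < e / 2" by blast
  obtain B where B: "\<And>x. \<bar>p x\<bar> \<le> B"
    using bounded_trig_poly[OF p(1)] by blast
  have F: "0 \<le> F"
    using f(2)[of 0] by linarith
  have "continuous_on {- B..B} (\<lambda>t. max (- F) (min F t))"
    by (intro continuous_intros)
  then obtain q where q: "real_polynomial_function q"
    "\<And>t. t \<in> {- B..B} \<Longrightarrow> \<bar>max (- F) (min F t) - q t\<bar> < e / 2"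
    using Stone_Weierstrass_real_polynomial_function[of "{- B..B}" "\<lambda>t. max (- F) (min F t)" "e / 2"] e by auto
  have q': "\<bar>max (- F) (min F (p x)) - q (p x)\<bar> < e / 2" for x
    using q(2)[of "p x"] B[of x] by (auto simp: abs_le_iff)
  show ?thesis
  proof
    show "trig_poly (\<lambda>x. q (p x))"
      by (rule trig_poly_compose[OF q(1) p(1)])
    show "\<bar>q (p x)\<bar> \<le> F + e" for x
      using q'[of x] F e by (auto simp: max_def min_def abs_if split: if_splits)
    \<comment> \<open>The values of \<open>f\<close> lie in [-F, F], so truncating
      \<open>p x\<close> to that interval does not increase its distance to \<open>f x\<close>; the
      two errors of e / 2 add up.\<close>
    show "\<bar>f x - q (p x)\<bar> < e" if "x \<in> K" for x
      using q'[of x] p(2)[OF that] f(2)[of x] by (auto simp: max_def min_def abs_if split: if_splits)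
  qed
qed

section \<open>From characteristic functions to integrals of trigonometric and Gaussian
  functions\<close>

lemma integrable_iexp_inner:
  fixes R :: "'b::euclidean_space measure"
  assumes "finite_measure R" and [measurable_cong]: "sets R = sets borel"
  shows "integrable R (\<lambda>x. iexp (u \<bullet> x))"
  by (rule finite_measure.integrable_const_bound[OF assms(1), where B = 1]) auto

lemma (in finite_measure) integrable_norm_bounded:
  fixes f :: "'a \<Rightarrow> 'b::{banach, second_countable_topology}"
  assumes [measurable]: "f \<in> borel_measurable M" and "\<And>x. norm (f x) \<le> B"
  shows "integrable M f"
  by (rule integrable_const_bound[where B = B]) (use assms in auto)

lemma integral_trig_poly_tendsto:
  fixes \<mu> :: "nat \<Rightarrow> 'b::euclidean_space measure"
  assumes fin: "\<And>n. finite_measure (\<mu> n)" "finite_measure N"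
    and sets: "\<And>n. sets (\<mu> n) = sets borel" "sets N = sets borel"
    and cf: "\<And>u. (\<lambda>n. CLINT x|\<mu> n. iexp (u \<bullet> x)) \<longlonglongrightarrow> (CLINT x|N. iexp (u \<bullet> x))"
    and "trig_poly p"
  shows "(\<lambda>n. \<integral>x. p x \<partial>\<mu> n) \<longlonglongrightarrow> (\<integral>x. p x \<partial>N)"
proof -
  \<comment> \<open>Integrability under every finite Borel measure is carried through the induction,
    because the additive case has to split the integrals under each \<open>\<mu> n\<close> and under
    \<open>N\<close>.\<close>
  have "(\<forall>R. finite_measure R \<longrightarrow> sets R = sets borel \<longrightarrow> integrable R p) \<and>
      (\<lambda>n. \<integral>x. p x \<partial>\<mu> n) \<longlonglongrightarrow> (\<integral>x. p x \<partial>N)"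
    using \<open>trig_poly p\<close>
  proof induction
    case (cos c u b)
    have eq: "c * cos (u \<bullet> x + b) = Re ((of_real c * iexp b) * iexp (u \<bullet> x))" for x
      by (simp add: Re_exp Im_exp cos_add algebra_simps)
    have int: "integrable R (\<lambda>x. (of_real c * iexp b) * iexp (u \<bullet> x))"
      if "finite_measure R" "sets R = sets borel" for R
      by (intro integrable_mult_right integrable_iexp_inner that)
    have "(\<lambda>n. Re (CLINT x|\<mu> n. (of_real c * iexp b) * iexp (u \<bullet> x)))
        \<longlonglongrightarrow> Re (CLINT x|N. (of_real c * iexp b) * iexp (u \<bullet> x))"
      unfolding integral_mult_right_zero by (intro tendsto_intros cf)
    moreover have "(\<integral>x. Re ((of_real c * iexp b) * iexp (u \<bullet> x)) \<partial>R) = Re (CLINT x|R. (of_real c * iexp b) * iexp (u \<bullet> x))"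
      if "finite_measure R" "sets R = sets borel" for R
      by (rule integral_Re[OF int[OF that]])
    ultimately show ?case
      unfolding eq using fin sets by (auto intro!: integrable_Re int simp del: Re_complex_of_real times_complex.sel)
  next
    case (add p q)
    then show ?case
      using fin sets by (auto intro!: tendsto_add)
  qed
  then show ?thesis by blast
qed

text \<open>The Gaussian exp (- s^2 / 2) is the characteristic function of the standard normal law
  at s = v \<bullet> x. By Fubini its integral is therefore an average of the characteristic
  function of \<open>N\<close> along the line spanned by \<open>v\<close>.\<close>

lemma integral_gaussian_eq:
  fixes N :: "'b::euclidean_space measure"
  assumes fin: "finite_measure N" and sets: "sets N = sets borel"
  shows "complex_of_real (\<integral>x. exp (- (v \<bullet> x)\<^sup>2 / 2) \<partial>N) =
    (CLINT t|std_normal_distribution. (CLINT x|N. iexp ((t *\<^sub>R v) \<bullet> x)))"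
proof -
  note [measurable_cong] = sets
  interpret N: finite_measure N by fact
  interpret S: real_distribution std_normal_distribution by (rule real_dist_normal_dist)
  interpret pair_sigma_finite N std_normal_distribution ..
  interpret NS: finite_measure "N \<Otimes>\<^sub>M std_normal_distribution"
    by (rule finite_measure_pair_measure) unfold_locales
  have "complex_of_real (\<integral>x. exp (- (v \<bullet> x)\<^sup>2 / 2) \<partial>N) = (CLINT x|N. char std_normal_distribution (v \<bullet> x))"
    unfolding char_std_normal_distribution by simp
  also have "\<dots> = (CLINT x|N. (CLINT t|std_normal_distribution. iexp ((t *\<^sub>R v) \<bullet> x)))"
    unfolding char_def by (simp add: mult.commute)
  also have "\<dots> = (CLINT t|std_normal_distribution. (CLINT x|N. iexp ((t *\<^sub>R v) \<bullet> x)))"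
    by (rule Fubini_integral[symmetric], rule NS.integrable_const_bound[where B = 1]) auto
  finally show ?thesis .
qed

text \<open>Dominated convergence along the line spanned by \<open>v\<close>: the characteristic
  functions are bounded by the total masses, which are their values at 0 and hence form a bounded
  sequence.\<close>

lemma integral_gaussian_tendsto:
  fixes \<mu> :: "nat \<Rightarrow> 'b::euclidean_space measure"
  assumes fin: "\<And>n. finite_measure (\<mu> n)" "finite_measure N"
    and sets: "\<And>n. sets (\<mu> n) = sets borel" "sets N = sets borel"
    and cf: "\<And>u. (\<lambda>n. CLINT x|\<mu> n. iexp (u \<bullet> x)) \<longlonglongrightarrow> (CLINT x|N. iexp (u \<bullet> x))"
  shows "(\<lambda>n. \<integral>x. exp (- (v \<bullet> x)\<^sup>2 / 2) \<partial>\<mu> n) \<longlonglongrightarrow> (\<integral>x. exp (- (v \<bullet> x)\<^sup>2 / 2) \<partial>N)"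
proof -
  interpret S: real_distribution std_normal_distribution by (rule real_dist_normal_dist)
  have le: "norm (CLINT x|\<mu> n. iexp (u \<bullet> x)) \<le> measure (\<mu> n) (space (\<mu> n))" for n u
    using integral_norm_bound[of "\<mu> n" "\<lambda>x. iexp (u \<bullet> x)"] by simp
  have "Bseq (\<lambda>n. CLINT x|\<mu> n. iexp (0 \<bullet> x))"
    using cf[of 0] by (intro convergent_imp_Bseq convergentI)
  then obtain B where "\<And>n. norm (CLINT x|\<mu> n. iexp (0 \<bullet> x)) \<le> B"
    unfolding Bseq_def by blast
  then have B: "measure (\<mu> n) (space (\<mu> n)) \<le> B" for n
    by simp
  have meas: "(\<lambda>t. CLINT x|R. iexp ((t *\<^sub>R v) \<bullet> x)) \<in> borel_measurable std_normal_distribution"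
    if "finite_measure R" and [measurable_cong]: "sets R = sets borel" for R
  proof -
    interpret finite_measure R by fact
    show ?thesis by measurable
  qed
  have "(\<lambda>n. CLINT t|std_normal_distribution. (CLINT x|\<mu> n. iexp ((t *\<^sub>R v) \<bullet> x)))
      \<longlonglongrightarrow> (CLINT t|std_normal_distribution. (CLINT x|N. iexp ((t *\<^sub>R v) \<bullet> x)))"
  proof (rule integral_dominated_convergence)
    show "integrable std_normal_distribution (\<lambda>_. B)"
      by simp
    show "AE t in std_normal_distribution. norm (CLINT x|\<mu> n. iexp ((t *\<^sub>R v) \<bullet> x)) \<le> B" for n
      by (intro always_eventually allI order_trans[OF le B])
  qed (intro meas fin sets always_eventually allI cf)+
  then show ?thesis
    unfolding integral_gaussian_eq[OF fin(1) sets(1), symmetric] integral_gaussian_eq[OF fin(2) sets(2), symmetric]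
    by (simp only: tendsto_of_real_iff)
qed

text \<open>A trigonometric polynomial approximates \<open>f\<close> only on a compact set, so mass
  far out must be controlled for all n at once. The function \<open>G c\<close> does this: it is
  bounded below off a cube, has a small \<open>N\<close>-integral for small \<open>c\<close>, and
  its integrals converge by \<open>integral_gaussian_tendsto\<close>.\<close>

theorem finite_measure_levy_continuity:
  fixes \<mu> :: "nat \<Rightarrow> 'b::euclidean_space measure" and f :: "'b \<Rightarrow> real"
  assumes fin: "\<And>n. finite_measure (\<mu> n)" "finite_measure N"
    and sets: "\<And>n. sets (\<mu> n) = sets borel" "sets N = sets borel"
    and cf: "\<And>u. (\<lambda>n. CLINT x|\<mu> n. iexp (u \<bullet> x)) \<longlonglongrightarrow> (CLINT x|N. iexp (u \<bullet> x))"
    and f: "continuous_on UNIV f" "bounded (range f)"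
  shows "(\<lambda>n. \<integral>x. f x \<partial>\<mu> n) \<longlonglongrightarrow> (\<integral>x. f x \<partial>N)"
proof (rule tendstoI)
  fix e :: real assume e: "0 < e"
  obtain F where F: "0 < F" "\<And>x. \<bar>f x\<bar> \<le> F"
    using f(2) by (auto simp: bounded_pos)
  \<comment> \<open>Each summand depends on one coordinate of x only, which is the form that
    \<open>integral_gaussian_tendsto\<close> treats.\<close>
  define G where "G c x = (\<Sum>b\<in>Basis. 1 - exp (- ((c *\<^sub>R b) \<bullet> x)\<^sup>2 / 2))" for c :: real and x :: 'b
  have G_meas[measurable]: "G c \<in> borel_measurable borel" for c
    unfolding G_def by measurable
  have G_nonneg: "0 \<le> G c x" and G_le: "G c x \<le> real DIM('b)" for c x
    using sum_mono[of Basis "\<lambda>b. 1 - exp (- ((c *\<^sub>R b) \<bullet> x)\<^sup>2 / 2)" "\<lambda>_. 1"]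
    by (auto simp: G_def intro!: sum_nonneg)
  have int: "integrable R g" if "finite_measure R" and [measurable_cong]: "sets R = sets borel"
    and [measurable]: "g \<in> borel_measurable borel" and "\<And>x. \<bar>g x\<bar> \<le> B" for R and g :: "'b \<Rightarrow> real" and B
    by (rule finite_measure.integrable_norm_bounded[of _ _ B]) (use that in auto)
  have int_exp: "integrable R (\<lambda>x. exp (- (v \<bullet> x)\<^sup>2 / 2))" if "finite_measure R" "sets R = sets borel" for R and v :: 'b
    by (rule int[OF that, of _ 1]) auto
  have intG: "integrable R (G c)" if "finite_measure R" "sets R = sets borel" for R c
    by (rule int[OF that, of _ "real DIM('b)"]) (use G_nonneg G_le in auto)
  have mass: "(\<lambda>n. measure (\<mu> n) (space (\<mu> n))) \<longlonglongrightarrow> measure N (space N)"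
    using integral_trig_poly_tendsto[OF fin sets cf trig_poly_const[of 1]] by simp
  have G_tendsto: "(\<lambda>n. \<integral>x. G c x \<partial>\<mu> n) \<longlonglongrightarrow> (\<integral>x. G c x \<partial>N)" for c
  proof -
    have eq: "(\<integral>x. G c x \<partial>R) = (\<Sum>b\<in>Basis. measure R (space R) - (\<integral>x. exp (- ((c *\<^sub>R b) \<bullet> x)\<^sup>2 / 2) \<partial>R))"
      if "finite_measure R" "sets R = sets borel" for R
    proof -
      interpret finite_measure R by fact
      have "(\<integral>x. G c x \<partial>R) = (\<Sum>b\<in>Basis. \<integral>x. 1 - exp (- ((c *\<^sub>R b) \<bullet> x)\<^sup>2 / 2) \<partial>R)"
        unfolding G_def
        by (intro Bochner_Integration.integral_sum Bochner_Integration.integrable_diff int_exp that integrable_const)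
      also have "\<dots> = (\<Sum>b\<in>Basis. measure R (space R) - (\<integral>x. exp (- ((c *\<^sub>R b) \<bullet> x)\<^sup>2 / 2) \<partial>R))"
      proof (rule sum.cong[OF refl])
        fix b :: 'b
        show "(\<integral>x. 1 - exp (- ((c *\<^sub>R b) \<bullet> x)\<^sup>2 / 2) \<partial>R) =
            measure R (space R) - (\<integral>x. exp (- ((c *\<^sub>R b) \<bullet> x)\<^sup>2 / 2) \<partial>R)"
          using Bochner_Integration.integral_diff[OF integrable_const int_exp[OF that, of "c *\<^sub>R b"], of 1]
          by simp
      qed
      finally show ?thesis .
    qed
    show ?thesis
      unfolding eq[OF fin(1) sets(1)] eq[OF fin(2) sets(2)]
      by (intro tendsto_sum tendsto_diff mass integral_gaussian_tendsto fin sets cf)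
  qed
  have "(\<lambda>m. \<integral>x. G (1 / real (Suc m)) x \<partial>N) \<longlonglongrightarrow> (\<integral>x. 0 \<partial>N)"
  proof (rule integral_dominated_convergence)
    show "integrable N (\<lambda>x. real DIM('b))"
      using fin(2) by (simp add: finite_measure.integrable_const)
    have "(\<lambda>m. G (1 / real (Suc m)) x) \<longlonglongrightarrow> (\<Sum>b\<in>Basis. 1 - exp (- ((0 *\<^sub>R b) \<bullet> x)\<^sup>2 / 2))" for x
      unfolding G_def
      by (intro tendsto_intros) (use LIMSEQ_inverse_real_of_nat in \<open>simp_all add: inverse_eq_divide\<close>)
    then show "AE x in N. (\<lambda>m. G (1 / real (Suc m)) x) \<longlonglongrightarrow> 0"
      by simp
    show "(\<lambda>x. 0) \<in> borel_measurable N" "G (1 / real (Suc m)) \<in> borel_measurable N" for m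
      using G_meas unfolding measurable_cong_sets[OF sets(2) refl] by auto
    show "AE x in N. norm (G (1 / real (Suc m)) x) \<le> real DIM('b)" for m
      using G_nonneg G_le by auto
  qed
  note G_lim = this
  \<comment> \<open>Off the cube the approximation error is at most 2 F + 1 while \<open>G c\<close>
    is at least 1 / 3, so this factor makes D * G c dominate the error there.\<close>
  define D where "D = 3 * (2 * F + 1)"
  obtain c where c: "0 < c" "(\<integral>x. G c x \<partial>N) < e / (8 * D)"
  proof -
    have "0 < e / (8 * D)"
      using e F by (simp add: D_def)
    then have "eventually (\<lambda>m. (\<integral>x. G (1 / real (Suc m)) x \<partial>N) < e / (8 * D)) sequentially"
      by (intro order_tendstoD(2)[OF G_lim]) auto
    then obtain m where "(\<integral>x. G (1 / real (Suc m)) x \<partial>N) < e / (8 * D)"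
      by (auto simp: eventually_sequentially)
    then show ?thesis
      by (intro that[of "1 / real (Suc m)"]) auto
  qed
  define K where "K = {x :: 'b. \<forall>b\<in>Basis. - 1 / c \<le> x \<bullet> b \<and> x \<bullet> b \<le> 1 / c}"
  have "K = cbox (- (\<Sum>b\<in>Basis. (1 / c) *\<^sub>R b)) (\<Sum>b\<in>Basis. (1 / c) *\<^sub>R b)"
    by (auto simp: K_def mem_box)
  then have K: "compact K" by simp
  \<comment> \<open>Off the cube some coordinate exceeds 1 / c in absolute value, so one summand of
    \<open>G c\<close> is at least 1 - exp (- 1 / 2); this is at least 1 / 3 because exp (1 / 2)
    \<ge> 3 / 2.\<close>
  have G_K: "1 / 3 \<le> G c x" if x: "x \<notin> K" for x
  proof -
    obtain b where b: "b \<in> Basis" "1 / c < \<bar>x \<bullet> b\<bar>"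
      using x unfolding K_def by fastforce
    then have "1 < c * \<bar>x \<bullet> b\<bar>"
      using c by (simp add: field_simps)
    then have "1 < (c * \<bar>x \<bullet> b\<bar>)\<^sup>2"
      by (simp add: one_less_power)
    then have "1 \<le> ((c *\<^sub>R b) \<bullet> x)\<^sup>2"
      by (simp add: inner_commute power_mult_distrib)
    then have "exp (- ((c *\<^sub>R b) \<bullet> x)\<^sup>2 / 2) \<le> exp (- (1 / 2))"
      by simp
    also have "\<dots> \<le> 2 / 3"
      using exp_ge_add_one_self[of "1 / 2"] by (simp add: exp_minus field_simps)
    finally have "1 / 3 \<le> 1 - exp (- ((c *\<^sub>R b) \<bullet> x)\<^sup>2 / 2)"
      by simp
    also have "\<dots> \<le> G c x"
      unfolding G_def by (rule member_le_sum) (use b in auto)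
    finally show ?thesis .
  qed
  \<comment> \<open>The bound 1 is the one built into \<open>D\<close>; the other makes \<epsilon>
    times the mass of \<open>N\<close> at most e / 8. Adding 1 to the mass allows for
    \<open>N\<close> being the zero measure.\<close>
  define \<epsilon> where "\<epsilon> = min 1 (e / (8 * (measure N (space N) + 1)))"
  have \<epsilon>: "0 < \<epsilon>" "\<epsilon> \<le> 1"
    using e by (auto simp: \<epsilon>_def add_nonneg_pos)
  obtain p where p: "trig_poly p" "\<And>x. x \<in> K \<Longrightarrow> \<bar>f x - p x\<bar> < \<epsilon>" "\<And>x. \<bar>p x\<bar> \<le> F + \<epsilon>"
    using trig_poly_approx[OF f(1) F(2) K \<epsilon>(1)] by blast
  have fp: "\<bar>f x - p x\<bar> \<le> \<epsilon> + D * G c x" for x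
  proof (cases "x \<in> K")
    case True
    have "0 \<le> D * G c x"
      using F G_nonneg by (simp add: D_def)
    with p(2)[OF True] show ?thesis by linarith
  next
    case False
    have "\<bar>f x - p x\<bar> \<le> F + (F + \<epsilon>)"
      using F(2)[of x] p(3)[of x] by linarith
    also have "\<dots> \<le> D * (1 / 3)"
      using \<epsilon> by (simp add: D_def)
    also have "\<dots> \<le> D * G c x"
      using F G_K[OF False] by (intro mult_left_mono) (auto simp: D_def)
    finally show ?thesis using \<epsilon> by linarith
  qed
  \<comment> \<open>A bound for the approximation error that makes sense under every finite measure.
    It converges along the sequence, since masses and integrals of \<open>G c\<close> do, so its
    smallness has to be checked for \<open>N\<close> only.\<close>
  define L where "L R = \<epsilon> * measure R (space R) + D * (\<integral>x. G c x \<partial>R)" for R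
  have [measurable]: "f \<in> borel_measurable borel" "p \<in> borel_measurable borel"
    by (auto intro!: borel_measurable_continuous_onI f(1) continuous_on_trig_poly p(1))
  have le: "\<bar>(\<integral>x. f x \<partial>R) - (\<integral>x. p x \<partial>R)\<bar> \<le> L R" if R: "finite_measure R" "sets R = sets borel" for R
  proof -
    interpret finite_measure R by fact
    note [simp] = int[OF R, of f F] int[OF R, of p "F + \<epsilon>"] intG[OF R]
    have "\<bar>(\<integral>x. f x \<partial>R) - (\<integral>x. p x \<partial>R)\<bar> = \<bar>\<integral>x. f x - p x \<partial>R\<bar>"
      using F p(3) by simp
    also have "\<dots> \<le> (\<integral>x. \<bar>f x - p x\<bar> \<partial>R)"
      by (rule integral_abs_bound)
    also have "\<dots> \<le> (\<integral>x. \<epsilon> + D * G c x \<partial>R)"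
      using F p(3) by (intro integral_mono fp) auto
    also have "\<dots> = L R"
      by (simp add: L_def)
    finally show ?thesis .
  qed
  have L: "L N < e / 4"
  proof -
    have "\<epsilon> * measure N (space N) \<le> e / (8 * (measure N (space N) + 1)) * (measure N (space N) + 1)"
      using e by (intro mult_mono) (auto simp: \<epsilon>_def)
    also have "\<dots> = e / 8"
    proof -
      have "e / (8 * m) * m = e / 8" if "0 < m" for m
        using that by simp
      then show ?thesis
        by this (simp add: add_nonneg_pos)
    qed
    finally have "\<epsilon> * measure N (space N) \<le> e / 8" .
    moreover have "D * (\<integral>x. G c x \<partial>N) < e / 8"
      using c(2) F by (simp add: D_def field_simps)
    ultimately show ?thesis
      by (simp add: L_def)
  qed
  have "(\<lambda>n. L (\<mu> n)) \<longlonglongrightarrow> L N"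
    unfolding L_def by (intro tendsto_add tendsto_mult tendsto_const mass G_tendsto)
  from order_tendstoD(2)[OF this L]
  have "eventually (\<lambda>n. L (\<mu> n) < e / 4) sequentially" .
  moreover have "eventually (\<lambda>n. dist (\<integral>x. p x \<partial>\<mu> n) (\<integral>x. p x \<partial>N) < e / 4) sequentially"
    using e by (intro tendstoD integral_trig_poly_tendsto fin sets cf p(1)) auto
  ultimately show "eventually (\<lambda>n. dist (\<integral>x. f x \<partial>\<mu> n) (\<integral>x. f x \<partial>N) < e) sequentially"
  proof eventually_elim
    case (elim n)
    then show ?case
      using le[OF fin(1) sets(1), of n] le[OF fin(2) sets(2)] L e unfolding dist_real_def by linarith
  qed
qed

section \<open>Differentiating characteristic functions\<close>

lemma has_vector_derivative_at_iff_tendsto: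
  "(f has_vector_derivative D) (at a) \<longleftrightarrow> ((\<lambda>s. (f s - f a) /\<^sub>R (s - a)) \<longlongrightarrow> D) (at a)"
proof -
  have eq: "norm ((f s - f a) - (s - a) *\<^sub>R D) / norm (s - a) = norm ((f s - f a) /\<^sub>R (s - a) - D)"
    if "s \<noteq> a" for s
  proof -
    have "(f s - f a) /\<^sub>R (s - a) - D = ((f s - f a) - (s - a) *\<^sub>R D) /\<^sub>R (s - a)"
      using that by (simp add: scaleR_diff_right)
    then show ?thesis
      by (simp add: divide_inverse mult.commute)
  qed
  have "(f has_vector_derivative D) (at a) \<longleftrightarrow>
      ((\<lambda>s. norm ((f s - f a) - (s - a) *\<^sub>R D) / norm (s - a)) \<longlongrightarrow> 0) (at a)"
    by (simp add: has_vector_derivative_def has_derivative_iff_norm bounded_linear_scaleR_left)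
  also have "\<dots> \<longleftrightarrow> ((\<lambda>s. norm ((f s - f a) /\<^sub>R (s - a) - D)) \<longlongrightarrow> 0) (at a)"
    by (rule Lim_cong_within) (auto simp: eq[unfolded real_norm_def])
  also have "\<dots> \<longleftrightarrow> ((\<lambda>s. (f s - f a) /\<^sub>R (s - a)) \<longlongrightarrow> D) (at a)"
    by (rule trans[OF tendsto_norm_zero_iff Lim_null[symmetric]])
  finally show ?thesis .
qed

text \<open>The mean value inequality turns the majorant \<open>g\<close> of the derivatives into a
  majorant of all difference quotients near \<open>s0\<close>, and dominated convergence applies
  along every sequence tending to \<open>s0\<close>.\<close>

lemma has_vector_derivative_lebesgue_integral:
  fixes f f' :: "real \<Rightarrow> 'a \<Rightarrow> 'b::{banach, second_countable_topology}"
  assumes e: "0 < e"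
    and int: "\<And>s. \<bar>s - s0\<bar> < e \<Longrightarrow> integrable M (f s)"
    and der: "\<And>s x. \<bar>s - s0\<bar> < e \<Longrightarrow> ((\<lambda>s. f s x) has_vector_derivative f' s x) (at s)"
    and meas: "f' s0 \<in> borel_measurable M"
    and bnd: "\<And>s x. \<bar>s - s0\<bar> < e \<Longrightarrow> norm (f' s x) \<le> g x"
    and g: "integrable M g"
  shows "((\<lambda>s. \<integral>x. f s x \<partial>M) has_vector_derivative (\<integral>x. f' s0 x \<partial>M)) (at s0)"
proof -
  define S where "S = ball s0 e"
  have S: "s \<in> S \<longleftrightarrow> \<bar>s - s0\<bar> < e" for s
    by (auto simp: S_def dist_real_def)
  have lip: "norm (f s x - f s0 x) \<le> g x * \<bar>s - s0\<bar>" if "s \<in> S" for s x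
  proof -
    have "norm (f s x - f s0 x) \<le> g x * norm (s - s0)"
    proof (rule differentiable_bound[where f = "\<lambda>s. f s x" and x = s and y = s0 and B = "g x" and S = S and f' = "\<lambda>t h. h *\<^sub>R f' t x"])
      show "((\<lambda>s. f s x) has_derivative (\<lambda>h. h *\<^sub>R f' t x)) (at t within S)" if "t \<in> S" for t
        using der[of t x] that by (simp add: S has_vector_derivative_def has_derivative_at_withinI)
      show "onorm (\<lambda>h. h *\<^sub>R f' t x) \<le> g x" if "t \<in> S" for t
        using bnd[of t x] that by (intro onorm_le) (auto simp: S mult.commute mult_left_mono)
      show "convex S" "s \<in> S" "s0 \<in> S"
        using that e by (simp_all add: S_def)
    qed
    then show ?thesis by simp
  qed
  define q where "q s x = (f s x - f s0 x) /\<^sub>R (s - s0)" for s x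
  have "((\<lambda>s. \<integral>x. q s x \<partial>M) \<longlongrightarrow> (\<integral>x. f' s0 x \<partial>M)) (at s0)"
    unfolding tendsto_at_iff_sequentially
  proof (intro allI impI)
    fix X assume X: "\<forall>i. X i \<in> UNIV - {s0}" "X \<longlonglongrightarrow> s0"
    have "eventually (\<lambda>i. X i \<in> S) sequentially"
      using X(2) e by (intro topological_tendstoD) (auto simp: S_def)
    then obtain N where N: "\<And>i. N \<le> i \<Longrightarrow> X i \<in> S"
      by (auto simp: eventually_sequentially)
    \<comment> \<open>Integrability and the bound on the quotients are known only inside
      \<open>S\<close>, which the sequence has entered from index \<open>N\<close> on.\<close>
    have "(\<lambda>i. \<integral>x. q (X (i + N)) x \<partial>M) \<longlonglongrightarrow> (\<integral>x. f' s0 x \<partial>M)"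
    proof (rule integral_dominated_convergence[OF meas _ g])
      show "q (X (i + N)) \<in> borel_measurable M" for i
        unfolding q_def using int[of s0] int[of "X (i + N)"] N[of "i + N"] e by (auto simp: S)
      have "(\<lambda>i. q (X i) x) \<longlonglongrightarrow> f' s0 x" for x
      proof -
        have "((\<lambda>s. q s x) \<longlongrightarrow> f' s0 x) (at s0)"
          using der[of s0 x] e unfolding has_vector_derivative_at_iff_tendsto q_def by simp
        with X show ?thesis
          unfolding tendsto_at_iff_sequentially by (auto simp: o_def)
      qed
      then show "AE x in M. (\<lambda>i. q (X (i + N)) x) \<longlonglongrightarrow> f' s0 x"
        by (intro always_eventually allI LIMSEQ_ignore_initial_segment)
      show "AE x in M. norm (q (X (i + N)) x) \<le> g x" for i
      proof (intro always_eventually allI)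
        fix x
        have "0 < \<bar>X (i + N) - s0\<bar>"
          using X(1) by simp
        moreover have "norm (f (X (i + N)) x - f s0 x) \<le> g x * \<bar>X (i + N) - s0\<bar>"
          by (rule lip[OF N]) simp
        ultimately show "norm (q (X (i + N)) x) \<le> g x"
          unfolding q_def norm_scaleR abs_inverse by (simp add: divide_inverse[symmetric] mult.commute[of "inverse _"] pos_divide_le_eq)
      qed
    qed
    then show "((\<lambda>s. \<integral>x. q s x \<partial>M) \<circ> X) \<longlonglongrightarrow> (\<integral>x. f' s0 x \<partial>M)"
      unfolding o_def by (rule LIMSEQ_offset)
  qed
  moreover have "eventually (\<lambda>s. (\<integral>x. q s x \<partial>M) = ((\<integral>x. f s x \<partial>M) - (\<integral>x. f s0 x \<partial>M)) /\<^sub>R (s - s0)) (at s0)"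
  proof -
    have "(\<integral>x. q s x \<partial>M) = ((\<integral>x. f s x \<partial>M) - (\<integral>x. f s0 x \<partial>M)) /\<^sub>R (s - s0)" if "\<bar>s - s0\<bar> < e" for s
      using int[OF that] int[of s0] e by (simp add: q_def[abs_def])
    then show ?thesis
      unfolding eventually_at using e by (intro exI[of _ e]) (auto simp: dist_real_def)
  qed
  ultimately have "((\<lambda>s. ((\<integral>x. f s x \<partial>M) - (\<integral>x. f s0 x \<partial>M)) /\<^sub>R (s - s0)) \<longlongrightarrow> (\<integral>x. f' s0 x \<partial>M)) (at s0)"
    using tendsto_cong by fast
  then show ?thesis
    by (simp add: has_vector_derivative_at_iff_tendsto)
qed

text \<open>A relational counterpart of \<open>partial_deriv\<close>: it includes the existence of
  the derivative at every point, so that sum, product and chain rules compose before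
  \<open>partial_deriv_eqI\<close> returns to the function.\<close>

definition has_partial_deriv :: "'d \<Rightarrow> (real ^ 'd \<Rightarrow> complex) \<Rightarrow> (real ^ 'd \<Rightarrow> complex) \<Rightarrow> bool" where
  "has_partial_deriv k \<phi> D \<longleftrightarrow> (\<forall>u. ((\<lambda>s. \<phi> (u + s *\<^sub>R axis k 1)) has_vector_derivative D u) (at 0))"

lemma has_partial_deriv_diff:
  "has_partial_deriv k f D \<Longrightarrow> has_partial_deriv k g E \<Longrightarrow>
    has_partial_deriv k (\<lambda>u. f u - g u) (\<lambda>u. D u - E u)"
  by (simp add: has_partial_deriv_def has_vector_derivative_diff)

lemma has_partial_deriv_mult:
  assumes "has_partial_deriv k f D" "has_partial_deriv k g E"
  shows "has_partial_deriv k (\<lambda>u. f u * g u) (\<lambda>u. f u * E u + D u * g u)"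
  unfolding has_partial_deriv_def
proof
  fix u
  show "((\<lambda>s. f (u + s *\<^sub>R axis k 1) * g (u + s *\<^sub>R axis k 1)) has_vector_derivative f u * E u + D u * g u) (at 0)"
    using has_vector_derivative_mult[of "\<lambda>s. f (u + s *\<^sub>R axis k 1)" "D u" 0 UNIV "\<lambda>s. g (u + s *\<^sub>R axis k 1)" "E u"]
      assms by (simp add: has_partial_deriv_def)
qed

lemma has_partial_deriv_exp:
  assumes "has_partial_deriv k f D"
  shows "has_partial_deriv k (\<lambda>u. exp (f u)) (\<lambda>u. exp (f u) * D u)"
  unfolding has_partial_deriv_def
proof
  fix u
  show "((\<lambda>s. exp (f (u + s *\<^sub>R axis k 1))) has_vector_derivative exp (f u) * D u) (at 0)"
    using field_vector_diff_chain_at[of "\<lambda>s. f (u + s *\<^sub>R axis k 1)" "D u" 0 exp "exp (f u)"] assms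
    by (auto simp: has_partial_deriv_def o_def mult.commute)
qed

lemma partial_deriv_eqI: "has_partial_deriv k f D \<Longrightarrow> partial_deriv k f = D"
  by (auto simp: has_partial_deriv_def partial_deriv_def fun_eq_iff intro!: vector_derivative_at)

lemma has_vector_derivative_iexp_line:
  fixes u e x :: "real ^ 'd"
  shows "((\<lambda>s. iexp ((u + s *\<^sub>R e) \<bullet> x)) has_vector_derivative
    \<i> * complex_of_real (e \<bullet> x) * iexp ((u + s *\<^sub>R e) \<bullet> x)) (at s)"
proof -
  have "((\<lambda>z. exp (\<i> * (of_real (u \<bullet> x) + z * of_real (e \<bullet> x)))) has_field_derivative
      exp (\<i> * (of_real (u \<bullet> x) + of_real s * of_real (e \<bullet> x))) * (\<i> * of_real (e \<bullet> x))) (at (of_real s))"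
    by (auto intro!: derivative_eq_intros)
  from has_vector_derivative_real_field[OF this]
  show ?thesis
    by (simp add: inner_add_left mult_ac)
qed

text \<open>The constant \<open>r\<close> covers two uses. For a probability measure it is 0; for a
  Levy measure with h x of order |x|, it is 1, since the difference iexp (u \<bullet> x) - 1
  supplies the second factor |x| needed for integrability near the origin.\<close>

lemma has_partial_deriv_integral_iexp:
  fixes N :: "(real ^ 'd) measure" and h :: "real ^ 'd \<Rightarrow> complex"
  assumes sets[measurable_cong]: "sets N = sets borel" and h[measurable]: "h \<in> borel_measurable borel"
    and int: "\<And>u. integrable N (\<lambda>x. h x * (iexp (u \<bullet> x) - r))"
    and int': "integrable N (\<lambda>x. norm (h x) * \<bar>x $ k\<bar>)"
  shows "has_partial_deriv k (\<lambda>u. CLINT x|N. h x * (iexp (u \<bullet> x) - r))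
    (\<lambda>u. CLINT x|N. \<i> * of_real (x $ k) * h x * iexp (u \<bullet> x))"
  unfolding has_partial_deriv_def
proof
  fix u :: "real ^ 'd"
  define e :: "real ^ 'd" where "e = axis k 1"
  have e: "e \<bullet> x = x $ k" for x
    by (simp add: e_def inner_axis' )
  have "((\<lambda>s. CLINT x|N. h x * (iexp ((u + s *\<^sub>R e) \<bullet> x) - r)) has_vector_derivative
      (CLINT x|N. h x * (\<i> * complex_of_real (e \<bullet> x) * iexp ((u + 0 *\<^sub>R e) \<bullet> x)))) (at 0)"
  proof (rule has_vector_derivative_lebesgue_integral[OF zero_less_one])
    show "((\<lambda>s. h x * (iexp ((u + s *\<^sub>R e) \<bullet> x) - r)) has_vector_derivative
      h x * (\<i> * complex_of_real (e \<bullet> x) * iexp ((u + s *\<^sub>R e) \<bullet> x))) (at s)" for s x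
      using has_vector_derivative_mult_right[OF
          has_vector_derivative_diff[OF has_vector_derivative_iexp_line[of u e x s] has_vector_derivative_const[of r]], of "h x"]
      by simp
    show "norm (h x * (\<i> * complex_of_real (e \<bullet> x) * iexp ((u + s *\<^sub>R e) \<bullet> x))) \<le> norm (h x) * \<bar>x $ k\<bar>" for s x
      by (simp add: norm_mult e)
    show "integrable N (\<lambda>x. h x * (iexp ((u + s *\<^sub>R e) \<bullet> x) - r))" for s
      by (rule int)
    show "integrable N (\<lambda>x. norm (h x) * \<bar>x $ k\<bar>)"
      by (rule int')
  qed simp
  then show "((\<lambda>s. CLINT x|N. h x * (iexp ((u + s *\<^sub>R axis k 1) \<bullet> x) - r)) has_vector_derivative
      (CLINT x|N. \<i> * of_real (x $ k) * h x * iexp (u \<bullet> x))) (at 0)"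
    unfolding e by (simp add: e_def mult_ac)
qed

lemma norm_iexp_diff_1_le: "norm (iexp y - 1) \<le> \<bar>y\<bar>"
  using iexp_approx1[of y 0] by simp

lemma norm_iexp_diff_linear_le: "norm (iexp y - 1 - \<i> * of_real y) \<le> y\<^sup>2 / 2"
  using iexp_approx1[of y 1] by (simp add: numeral_2_eq_2 algebra_simps)

lemma inner_square_le: "(u \<bullet> x)\<^sup>2 \<le> (norm u)\<^sup>2 * (norm x)\<^sup>2" for u x :: "real ^ 'd"
  using Cauchy_Schwarz_ineq2[of u x] by (metis abs_ge_zero power2_abs power_mono power_mult_distrib)

lemma component_square_le: "(x $ k)\<^sup>2 \<le> (norm x)\<^sup>2" for x :: "real ^ 'd"
  using component_le_norm_cart[of x k] by (metis abs_ge_zero power2_abs power_mono)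

section \<open>Cumulant functions of Levy measures with finite fourth moment\<close>

locale levy_moment4 =
  fixes \<nu> :: "(real ^ 'd) measure"
  assumes levy_measure4: "levy_measure4 \<nu>"
begin

lemma sets_eq[measurable_cong]: "sets \<nu> = sets borel"
  using levy_measure4 by (simp add: levy_measure4_def levy_measure_def)

lemma integrable_power4: "integrable \<nu> (\<lambda>x. (norm x) ^ 4)"
  using levy_measure4 by (intro integrableI_nonneg) (auto simp: levy_measure4_def)

text \<open>Near the origin the Levy condition controls the square, and away from it the fourth
  power dominates.\<close>

lemma integrable_power2: "integrable \<nu> (\<lambda>x. (norm x)\<^sup>2)"
proof (rule Bochner_Integration.integrable_bound)
  have "integrable \<nu> (\<lambda>x. min 1 ((norm x)\<^sup>2))"
    using levy_measure4 by (intro integrableI_nonneg) (auto simp: levy_measure4_def levy_measure_def)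
  then show "integrable \<nu> (\<lambda>x. min 1 ((norm x)\<^sup>2) + (norm x) ^ 4)"
    by (intro Bochner_Integration.integrable_add integrable_power4)
  have "a \<le> min 1 a + a\<^sup>2" if "0 \<le> a" for a :: real
    using that mult_right_mono[of 1 a a] by (cases "a \<le> 1") (auto simp: power2_eq_square intro: add_increasing)
  from this[of "(norm x)\<^sup>2" for x :: "real ^ 'd"]
  show "AE x in \<nu>. norm ((norm x)\<^sup>2) \<le> norm (min 1 ((norm x)\<^sup>2) + (norm x) ^ 4)"
    by (simp add: power_mult[symmetric])
qed simp

lemma integrable_power3: "integrable \<nu> (\<lambda>x. (norm x) ^ 3)"
proof (rule Bochner_Integration.integrable_bound)
  show "integrable \<nu> (\<lambda>x. (norm x)\<^sup>2 + (norm x) ^ 4)"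
    by (intro Bochner_Integration.integrable_add integrable_power2 integrable_power4)
  have "a ^ 3 \<le> a\<^sup>2 + a ^ 4" if "0 \<le> a" for a :: real
  proof -
    \<comment> \<open>The difference a^2 + a^4 - a^3 equals a^2 (a^2 - a + 1), and the second factor
      is completed to a square.\<close>
    have "0 \<le> a\<^sup>2 * ((a - 1 / 2)\<^sup>2 + 3 / 4)" by simp
    also have "\<dots> = a\<^sup>2 + a ^ 4 - a ^ 3"
      by (simp add: power2_eq_square algebra_simps eval_nat_numeral)
    finally show ?thesis by simp
  qed
  then show "AE x in \<nu>. norm ((norm x) ^ 3) \<le> norm ((norm x)\<^sup>2 + (norm x) ^ 4)"
    by simp
qed simp

lemma integrable_le_power2:
  fixes f :: "real ^ 'd \<Rightarrow> 'b::{banach, second_countable_topology}"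
  assumes [measurable]: "f \<in> borel_measurable borel" and le: "\<And>x. norm (f x) \<le> c * (norm x)\<^sup>2"
  shows "integrable \<nu> f"
  by (rule Bochner_Integration.integrable_bound[OF integrable_mult_right[OF integrable_power2, of c]])
    (use order_trans[OF le abs_ge_self] in auto)

definition cumulant :: "real ^ 'd \<Rightarrow> real ^ 'd \<Rightarrow> complex" where
  "cumulant \<alpha> u = \<i> * of_real (u \<bullet> \<alpha>) + (CLINT x|\<nu>. iexp (u \<bullet> x) - 1 - \<i> * of_real (u \<bullet> x))"

definition cumulant1 :: "real ^ 'd \<Rightarrow> 'd \<Rightarrow> real ^ 'd \<Rightarrow> complex" where
  "cumulant1 \<alpha> k u = \<i> * of_real (\<alpha> $ k) + (CLINT x|\<nu>. \<i> * of_real (x $ k) * (iexp (u \<bullet> x) - 1))"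

text \<open>The integrand is - (x $ k)^2 * iexp (u \<bullet> x), kept as a product in the form that
  \<open>has_partial_deriv_integral_iexp\<close> produces. The drift no longer occurs.\<close>

definition cumulant2 :: "'d \<Rightarrow> real ^ 'd \<Rightarrow> complex" where
  "cumulant2 k u = (CLINT x|\<nu>. \<i> * of_real (x $ k) * (\<i> * of_real (x $ k)) * iexp (u \<bullet> x))"

lemma levy_cf_eq_exp_cumulant: "levy_cf \<nu> \<alpha> u = exp (cumulant \<alpha> u)"
  by (simp add: levy_cf_def cumulant_def)

lemma integrable_cumulant: "integrable \<nu> (\<lambda>x. iexp (u \<bullet> x) - 1 - \<i> * of_real (u \<bullet> x))"
proof (rule integrable_le_power2)
  fix x
  show "norm (iexp (u \<bullet> x) - 1 - \<i> * of_real (u \<bullet> x)) \<le> ((norm u)\<^sup>2 / 2) * (norm x)\<^sup>2"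
    using norm_iexp_diff_linear_le[of "u \<bullet> x"] inner_square_le[of u x] by simp
qed simp

lemma norm_cumulant1_integrand_le:
  "norm (\<i> * of_real (x $ k) * (iexp (u \<bullet> x) - 1)) \<le> norm u * (norm x)\<^sup>2" for x u :: "real ^ 'd"
proof -
  have "\<bar>x $ k\<bar> * norm (iexp (u \<bullet> x) - 1) \<le> norm x * (norm u * norm x)"
    using order_trans[OF norm_iexp_diff_1_le Cauchy_Schwarz_ineq2] component_le_norm_cart
    by (intro mult_mono) auto
  then show ?thesis
    by (simp add: norm_mult power2_eq_square mult_ac)
qed

text \<open>Differentiating the linear compensator leaves the factor iexp (u \<bullet> x) - 1, so
  the derivative of the integrand is at most |u| |x|^2. For displacements below 1 along a unit
  vector, (|u| + 1) |x|^2 is a common majorant.\<close>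

lemma has_partial_deriv_cumulant: "has_partial_deriv k (cumulant \<alpha>) (cumulant1 \<alpha> k)"
  unfolding has_partial_deriv_def
proof
  fix u :: "real ^ 'd"
  define e :: "real ^ 'd" where "e = axis k 1"
  have e: "e \<bullet> x = x $ k" for x
    by (simp add: e_def inner_axis')
  have line: "((\<lambda>s. \<i> * complex_of_real ((u + s *\<^sub>R e) \<bullet> x)) has_vector_derivative \<i> * of_real (x $ k)) (at s)" for s x
    unfolding inner_add_left inner_scaleR_left e by (auto intro!: derivative_eq_intros)
  have "((\<lambda>s. CLINT x|\<nu>. iexp ((u + s *\<^sub>R e) \<bullet> x) - 1 - \<i> * of_real ((u + s *\<^sub>R e) \<bullet> x)) has_vector_derivative
      (CLINT x|\<nu>. \<i> * of_real (x $ k) * (iexp ((u + 0 *\<^sub>R e) \<bullet> x) - 1))) (at 0)"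
  proof (rule has_vector_derivative_lebesgue_integral[OF zero_less_one])
    show "((\<lambda>s. iexp ((u + s *\<^sub>R e) \<bullet> x) - 1 - \<i> * of_real ((u + s *\<^sub>R e) \<bullet> x)) has_vector_derivative
      \<i> * of_real (x $ k) * (iexp ((u + s *\<^sub>R e) \<bullet> x) - 1)) (at s)" for s x
      using has_vector_derivative_diff[OF has_vector_derivative_diff[OF
          has_vector_derivative_iexp_line[of u e x s] has_vector_derivative_const[of 1]] line[of x s]]
      by (simp add: e right_diff_distrib)
    show "norm (\<i> * of_real (x $ k) * (iexp ((u + s *\<^sub>R e) \<bullet> x) - 1)) \<le> (norm u + 1) * (norm x)\<^sup>2"
      if "\<bar>s - 0\<bar> < 1" for s x
    proof -
      have "norm (u + s *\<^sub>R e) \<le> norm u + 1"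
        using that norm_triangle_ineq[of u "s *\<^sub>R e"] by (simp add: e_def)
      then show ?thesis
        by (rule order_trans[OF norm_cumulant1_integrand_le mult_right_mono]) simp
    qed
    show "integrable \<nu> (\<lambda>x. iexp ((u + s *\<^sub>R e) \<bullet> x) - 1 - \<i> * of_real ((u + s *\<^sub>R e) \<bullet> x))" for s
      by (rule integrable_cumulant)
    show "integrable \<nu> (\<lambda>x. (norm u + 1) * (norm x)\<^sup>2)"
      by (intro integrable_mult_right integrable_power2)
  qed simp
  with line[of \<alpha> 0]
  show "((\<lambda>s. cumulant \<alpha> (u + s *\<^sub>R axis k 1)) has_vector_derivative cumulant1 \<alpha> k u) (at 0)"
    unfolding cumulant_def cumulant1_def e_def[symmetric] by (auto intro!: has_vector_derivative_add)
qed

lemma has_partial_deriv_cumulant1: "has_partial_deriv k (cumulant1 \<alpha> k) (cumulant2 k)"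
proof -
  have "has_partial_deriv k (\<lambda>u. CLINT x|\<nu>. \<i> * of_real (x $ k) * (iexp (u \<bullet> x) - 1)) (cumulant2 k)"
    unfolding cumulant2_def
  proof (rule has_partial_deriv_integral_iexp[OF sets_eq, where h = "\<lambda>x. \<i> * of_real (x $ k)" and r = 1 and k = k])
    show "integrable \<nu> (\<lambda>x. \<i> * of_real (x $ k) * (iexp (u \<bullet> x) - 1))" for u
      using norm_cumulant1_integrand_le by (rule integrable_le_power2[rotated]) simp
    show "integrable \<nu> (\<lambda>x. norm (\<i> * complex_of_real (x $ k)) * \<bar>x $ k\<bar>)"
      using component_square_le[of _ k]
      by (intro integrable_le_power2[where c = 1]) (auto simp: norm_mult power2_eq_square)
  qed simp
  then show ?thesis
    unfolding has_partial_deriv_def cumulant1_def by (auto intro!: derivative_eq_intros)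
qed

lemma has_partial_deriv_levy_cf:
  "has_partial_deriv k (levy_cf \<nu> \<alpha>) (\<lambda>u. levy_cf \<nu> \<alpha> u * cumulant1 \<alpha> k u)"
  using has_partial_deriv_exp[OF has_partial_deriv_cumulant]
  unfolding levy_cf_eq_exp_cumulant[abs_def] .

lemma has_partial_deriv2_levy_cf:
  "has_partial_deriv k (\<lambda>u. levy_cf \<nu> \<alpha> u * cumulant1 \<alpha> k u)
    (\<lambda>u. levy_cf \<nu> \<alpha> u * ((cumulant1 \<alpha> k u)\<^sup>2 + cumulant2 k u))"
  using has_partial_deriv_mult[OF has_partial_deriv_levy_cf has_partial_deriv_cumulant1]
  by (simp add: power2_eq_square algebra_simps)

lemma sum_cumulant2: "(\<Sum>k\<in>UNIV. cumulant2 k u) = - (CLINT x|\<nu>. of_real ((norm x)\<^sup>2) * iexp (u \<bullet> x))"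
proof -
  have int: "integrable \<nu> (\<lambda>x. \<i> * of_real (x $ k) * (\<i> * of_real (x $ k)) * iexp (u \<bullet> x))" for k
    using component_square_le[of _ k]
    by (intro integrable_le_power2[where c = 1]) (auto simp: norm_mult power2_eq_square)
  have "(norm x)\<^sup>2 = (\<Sum>k\<in>UNIV. (x $ k)\<^sup>2)" for x :: "real ^ 'd"
    unfolding power2_norm_eq_inner inner_vec_def by (simp add: power2_eq_square)
  moreover have "\<i> * of_real a * (\<i> * of_real a) * z = - (of_real (a\<^sup>2) * z)" for a z
    by (simp add: power2_eq_square mult_ac)
  ultimately have "(\<Sum>k\<in>UNIV. \<i> * of_real (x $ k) * (\<i> * of_real (x $ k)) * iexp (u \<bullet> x))
      = - (of_real ((norm x)\<^sup>2) * iexp (u \<bullet> x))" for x :: "real ^ 'd"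
    by (simp only: of_real_sum sum_distrib_right sum_negf)
  then show ?thesis
    unfolding cumulant2_def by (subst Bochner_Integration.integral_sum[symmetric]) (simp_all add: int)
qed

lemma finite_measure_density: "finite_measure (density \<nu> (\<lambda>x. ennreal ((norm x)\<^sup>2)))"
  using integrable_power2 by (intro finite_measureI) (simp add: emeasure_density nn_integral_eq_integral)

end

section \<open>Fourth moments of the increments\<close>

lemma abs_cos_approx: "\<bar>cos y - (1 - y\<^sup>2 / 2)\<bar> \<le> y ^ 4" for y :: real
proof -
  have "\<bar>Re (iexp y - (\<Sum>k\<le>3. (\<i> * of_real y) ^ k / fact k))\<bar> \<le> \<bar>y\<bar> ^ 4 / fact 4"
    using order_trans[OF abs_Re_le_cmod iexp_approx1[of y 3]] by (simp add: numeral_eq_Suc)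
  also have "Re (iexp y - (\<Sum>k\<le>3. (\<i> * of_real y) ^ k / fact k)) = cos y - (1 - y\<^sup>2 / 2)"
    by (simp add: numeral_eq_Suc Re_exp)
  also have "\<bar>y\<bar> ^ 4 / fact 4 \<le> y ^ 4"
    by (simp add: fact_numeral)
  finally show ?thesis .
qed

lemma abs_sin_approx: "\<bar>sin y - y\<bar> \<le> \<bar>y\<bar> ^ 3" for y :: real
proof -
  have "\<bar>Im (iexp y - (\<Sum>k\<le>2. (\<i> * of_real y) ^ k / fact k))\<bar> \<le> \<bar>y\<bar> ^ 3 / fact 3"
    using order_trans[OF abs_Im_le_cmod iexp_approx1[of y 2]] by (simp add: numeral_eq_Suc)
  also have "Im (iexp y - (\<Sum>k\<le>2. (\<i> * of_real y) ^ k / fact k)) = sin y - y"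
    by (simp add: numeral_eq_Suc Im_exp)
  also have "\<bar>y\<bar> ^ 3 / fact 3 \<le> \<bar>y\<bar> ^ 3"
    by (simp add: fact_numeral)
  finally show ?thesis .
qed

lemma abs_exp_nonpos_approx:
  assumes "y \<le> (0::real)"
  shows "\<bar>exp y - (1 + y)\<bar> \<le> y\<^sup>2"
proof -
  have "exp y = 1 / exp (- y)"
    by (simp add: exp_minus field_simps)
  also have "\<dots> \<le> 1 / (1 - y)"
    using exp_ge_add_one_self[of "- y"] assms by (intro divide_left_mono) auto
  \<comment> \<open>Because (1 - y) (1 + y + y^2) = 1 - y^3, which is at least 1 for y \<le>
    0.\<close>
  also have "\<dots> \<le> 1 + y + y\<^sup>2"
  proof -
    have "0 \<le> - (y * y\<^sup>2)"
      using assms by (simp add: mult_nonpos_nonneg)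
    then show ?thesis
      using assms by (simp add: pos_divide_le_eq algebra_simps power2_eq_square)
  qed
  finally show ?thesis
    using exp_ge_add_one_self[of y] by simp
qed

text \<open>Here A + i B will be the cumulant at \<open>h\<close> times a unit vector, with a the
  drift component and b the second moment of \<nu> in that direction; exp A * cos B is the real part
  of the characteristic function. \<open>C\<close> and \<open>D\<close> are the fourth order error
  constants of exp A and cos B. A cubic error in B is enough, as B^2 - a^2 h^2 has a further factor
  of order h.\<close>

lemma exp_mult_cos_expansion:
  fixes A B a b c h :: real
  assumes "A \<le> 0" and A: "\<bar>A + b / 2 * h\<^sup>2\<bar> \<le> c * h ^ 4" and B: "\<bar>B - a * h\<bar> \<le> c * \<bar>h\<bar> ^ 3"
    and "0 \<le> b" "0 \<le> c" "\<bar>h\<bar> \<le> 1"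
  defines "C \<equiv> c + (b + c)\<^sup>2" and "D \<equiv> (\<bar>a\<bar> + c) ^ 4 + c * (2 * \<bar>a\<bar> + c)"
  shows "\<bar>exp A * cos B - (1 - (a\<^sup>2 + b) / 2 * h\<^sup>2)\<bar> \<le> (D + C * (1 + a\<^sup>2) + a\<^sup>2 * b) * h ^ 4"
proof -
  have h2: "h\<^sup>2 \<le> 1" "\<bar>h\<bar> ^ 3 \<le> \<bar>h\<bar>" "h ^ 4 \<le> h\<^sup>2"
    using \<open>\<bar>h\<bar> \<le> 1\<close> power_decreasing[of 1 3 "\<bar>h\<bar>"] power_decreasing[of 2 4 "\<bar>h\<bar>"] power_decreasing[of 0 2 "\<bar>h\<bar>"]
    by simp_all
  have "\<bar>A\<bar> \<le> \<bar>A + b / 2 * h\<^sup>2\<bar> + b * h\<^sup>2"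
  proof -
    have "\<bar>A\<bar> \<le> \<bar>A + t\<bar> + 2 * t" if "0 \<le> t" for t
      using that by linarith
    from this[of "b / 2 * h\<^sup>2"] show ?thesis
      using \<open>0 \<le> b\<close> by simp
  qed
  also have "\<dots> \<le> c * h\<^sup>2 + b * h\<^sup>2"
    using A mult_left_mono[OF h2(3) \<open>0 \<le> c\<close>] by simp
  finally have "\<bar>A\<bar> \<le> (b + c) * h\<^sup>2"
    by (simp add: algebra_simps)
  then have "\<bar>A\<bar>\<^sup>2 \<le> ((b + c) * h\<^sup>2)\<^sup>2"
    by (intro power_mono) auto
  then have "A\<^sup>2 \<le> (b + c)\<^sup>2 * h ^ 4"
    by (simp add: power_mult_distrib)
  then have eA: "\<bar>exp A - (1 - b / 2 * h\<^sup>2)\<bar> \<le> C * h ^ 4"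
    using abs_exp_nonpos_approx[OF \<open>A \<le> 0\<close>] A unfolding C_def distrib_right by linarith
  have "\<bar>B\<bar> \<le> \<bar>B - a * h\<bar> + \<bar>a\<bar> * \<bar>h\<bar>"
    by (simp add: abs_mult[symmetric])
  also have "\<dots> \<le> c * \<bar>h\<bar> + \<bar>a\<bar> * \<bar>h\<bar>"
    using B mult_left_mono[OF h2(2) \<open>0 \<le> c\<close>] by simp
  finally have B': "\<bar>B\<bar> \<le> (\<bar>a\<bar> + c) * \<bar>h\<bar>"
    by (simp add: algebra_simps)
  then have "\<bar>B\<bar> ^ 4 \<le> ((\<bar>a\<bar> + c) * \<bar>h\<bar>) ^ 4"
    by (intro power_mono) auto
  then have B4: "B ^ 4 \<le> (\<bar>a\<bar> + c) ^ 4 * h ^ 4"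
    by (simp add: power_mult_distrib)
  have "\<bar>B\<^sup>2 - a\<^sup>2 * h\<^sup>2\<bar> = \<bar>B - a * h\<bar> * \<bar>B + a * h\<bar>"
    by (simp add: abs_mult[symmetric] power2_eq_square algebra_simps)
  also have "\<dots> \<le> (c * \<bar>h\<bar> ^ 3) * ((2 * \<bar>a\<bar> + c) * \<bar>h\<bar>)"
  proof (intro mult_mono B)
    have "\<bar>B + a * h\<bar> \<le> \<bar>B\<bar> + \<bar>a\<bar> * \<bar>h\<bar>"
      by (simp add: abs_mult[symmetric])
    with B' show "\<bar>B + a * h\<bar> \<le> (2 * \<bar>a\<bar> + c) * \<bar>h\<bar>"
      by (simp add: algebra_simps)
  qed (use \<open>0 \<le> c\<close> in auto)
  also have "\<dots> = c * (2 * \<bar>a\<bar> + c) * \<bar>h\<bar> ^ 4"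
    by (simp add: eval_nat_numeral)
  finally have "\<bar>B\<^sup>2 - a\<^sup>2 * h\<^sup>2\<bar> \<le> c * (2 * \<bar>a\<bar> + c) * h ^ 4"
    by simp
  then have cB: "\<bar>cos B - (1 - a\<^sup>2 / 2 * h\<^sup>2)\<bar> \<le> D * h ^ 4"
    using abs_cos_approx[of B] B4 unfolding D_def distrib_right by (auto simp: abs_if split: if_splits)
  \<comment> \<open>Telescoping of the product: the error of cos B is multiplied by exp A \<le> 1,
    the error of exp A by the quadratic approximation of cos B, and the product of the two quadratic
    terms is itself of order h^4.\<close>
  have "x * y - (1 - (p + q) / 2 * t) = x * (y - (1 - p / 2 * t)) + (x - (1 - q / 2 * t)) * (1 - p / 2 * t)
      + p * q / 4 * (t * t)" for x y p q t :: real
    by (simp add: field_simps)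
  from this[of "exp A" "cos B" "a\<^sup>2" b "h\<^sup>2"]
  have eq: "exp A * cos B - (1 - (a\<^sup>2 + b) / 2 * h\<^sup>2) = exp A * (cos B - (1 - a\<^sup>2 / 2 * h\<^sup>2))
      + (exp A - (1 - b / 2 * h\<^sup>2)) * (1 - a\<^sup>2 / 2 * h\<^sup>2) + a\<^sup>2 * b / 4 * h ^ 4"
    by (simp only: power_add[symmetric]) simp
  have "\<bar>exp A * cos B - (1 - (a\<^sup>2 + b) / 2 * h\<^sup>2)\<bar> \<le> \<bar>exp A * (cos B - (1 - a\<^sup>2 / 2 * h\<^sup>2))\<bar>
      + \<bar>(exp A - (1 - b / 2 * h\<^sup>2)) * (1 - a\<^sup>2 / 2 * h\<^sup>2)\<bar> + \<bar>a\<^sup>2 * b / 4 * h ^ 4\<bar>"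
    unfolding eq by (rule order_trans[OF abs_triangle_ineq add_right_mono[OF abs_triangle_ineq]])
  also have "\<dots> \<le> 1 * (D * h ^ 4) + C * h ^ 4 * (1 + a\<^sup>2) + a\<^sup>2 * b * h ^ 4"
  proof (intro add_mono)
    show "\<bar>exp A * (cos B - (1 - a\<^sup>2 / 2 * h\<^sup>2))\<bar> \<le> 1 * (D * h ^ 4)"
      unfolding abs_mult using \<open>A \<le> 0\<close> by (intro mult_mono cB) auto
    have "\<bar>1 - a\<^sup>2 / 2 * h\<^sup>2\<bar> \<le> 1 + a\<^sup>2"
    proof -
      have "a\<^sup>2 * h\<^sup>2 \<le> a\<^sup>2 * 1" "0 \<le> a\<^sup>2 * h\<^sup>2"
        by (intro mult_left_mono h2) auto
      then have "- (1 + a\<^sup>2) \<le> 1 - a\<^sup>2 / 2 * h\<^sup>2" "1 - a\<^sup>2 / 2 * h\<^sup>2 \<le> 1 + a\<^sup>2"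
        unfolding times_divide_eq_left using zero_le_power2[of a] by linarith+
      then show ?thesis
        by (rule abs_leI[OF _ minus_le_iff[THEN iffD1], rotated])
    qed
    then show "\<bar>(exp A - (1 - b / 2 * h\<^sup>2)) * (1 - a\<^sup>2 / 2 * h\<^sup>2)\<bar> \<le> C * h ^ 4 * (1 + a\<^sup>2)"
      unfolding abs_mult by (intro mult_mono eA) (auto simp: C_def \<open>0 \<le> c\<close>)
    show "\<bar>a\<^sup>2 * b / 4 * h ^ 4\<bar> \<le> a\<^sup>2 * b * h ^ 4"
      using \<open>0 \<le> b\<close> by (simp add: abs_mult)
  qed
  finally show ?thesis
    by (simp add: algebra_simps)
qed

context levy_moment4
begin

text \<open>Taking real parts removes the odd powers of \<open>h\<close>, which is why the remainder
  has order four. The coefficient \<open>q\<close> may stay unspecified, since it cancels in the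
  fourth difference formed later.\<close>

lemma Re_levy_cf_expansion:
  obtains q K where "0 \<le> K"
    "\<And>h. \<bar>h\<bar> \<le> 1 \<Longrightarrow> \<bar>Re (levy_cf \<nu> \<alpha> (h *\<^sub>R axis k 1)) - (1 - q * h\<^sup>2)\<bar> \<le> K * h ^ 4"
proof -
  define b where "b = (\<integral>x. (x $ k)\<^sup>2 \<partial>\<nu>)"
  \<comment> \<open>The fourth moment bounds the remainder of the real part of the cumulant, the
    third moment that of the imaginary part; their sum serves for both.\<close>
  define c where "c = (\<integral>x. (norm x) ^ 4 \<partial>\<nu>) + (\<integral>x. (norm x) ^ 3 \<partial>\<nu>)"
  have c: "0 \<le> c"
    by (simp add: c_def)
  have b: "0 \<le> b"
    by (simp add: b_def)
  have int2: "integrable \<nu> (\<lambda>x. (x $ k)\<^sup>2)"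
    using component_square_le[of _ k] by (intro integrable_le_power2[where c = 1]) auto
  define C where "C = c + (b + c)\<^sup>2"
  define D where "D = (\<bar>\<alpha> $ k\<bar> + c) ^ 4 + c * (2 * \<bar>\<alpha> $ k\<bar> + c)"
  define K where "K = D + C * (1 + (\<alpha> $ k)\<^sup>2) + (\<alpha> $ k)\<^sup>2 * b"
  have "0 \<le> K"
    unfolding K_def C_def D_def using b c by (intro add_nonneg_nonneg mult_nonneg_nonneg) auto
  moreover have "\<bar>Re (levy_cf \<nu> \<alpha> (h *\<^sub>R axis k 1)) - (1 - ((\<alpha> $ k)\<^sup>2 + b) / 2 * h\<^sup>2)\<bar> \<le> K * h ^ 4"
    if h: "\<bar>h\<bar> \<le> 1" for h
  proof -
    define u :: "real ^ 'd" where "u = h *\<^sub>R axis k 1"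
    have u: "u \<bullet> x = h * x $ k" for x
      by (simp add: u_def inner_axis')
    note int = integrable_cumulant[of u, unfolded u]
    define A where "A = (\<integral>x. cos (h * x $ k) - 1 \<partial>\<nu>)"
    define B where "B = h * \<alpha> $ k + (\<integral>x. sin (h * x $ k) - h * x $ k \<partial>\<nu>)"
    have intA: "integrable \<nu> (\<lambda>x. cos (h * x $ k) - 1)" and intB: "integrable \<nu> (\<lambda>x. sin (h * x $ k) - h * x $ k)"
      using integrable_Re[OF int] integrable_Im[OF int] by (simp_all add: Re_exp Im_exp)
    have AB: "Re (cumulant \<alpha> u) = A" "Im (cumulant \<alpha> u) = B"
      unfolding cumulant_def u A_def B_def using integral_Re[OF int] integral_Im[OF int]
      by (simp_all add: Re_exp Im_exp)
    have "Re (levy_cf \<nu> \<alpha> u) = exp A * cos B"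
      by (simp add: levy_cf_eq_exp_cumulant Re_exp AB)
    moreover have "A \<le> 0"
    proof -
      have "A \<le> (\<integral>x. 0 \<partial>\<nu>)"
        unfolding A_def by (rule integral_mono[OF intA]) auto
      then show ?thesis by simp
    qed
    moreover have "\<bar>A + b / 2 * h\<^sup>2\<bar> \<le> c * h ^ 4"
    proof -
      have "A + b / 2 * h\<^sup>2 = (\<integral>x. (cos (h * x $ k) - 1) + h\<^sup>2 / 2 * (x $ k)\<^sup>2 \<partial>\<nu>)"
        unfolding A_def b_def using intA int2 by simp
      then have "\<bar>A + b / 2 * h\<^sup>2\<bar> = \<bar>\<integral>x. (cos (h * x $ k) - 1) + h\<^sup>2 / 2 * (x $ k)\<^sup>2 \<partial>\<nu>\<bar>"
        by (rule arg_cong)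
      also have "\<dots> \<le> (\<integral>x. \<bar>(cos (h * x $ k) - 1) + h\<^sup>2 / 2 * (x $ k)\<^sup>2\<bar> \<partial>\<nu>)"
        by (rule integral_abs_bound)
      also have "\<dots> \<le> (\<integral>x. h ^ 4 * (norm x) ^ 4 \<partial>\<nu>)"
      proof (rule integral_mono)
        fix x :: "real ^ 'd"
        have "\<bar>(cos (h * x $ k) - 1) + h\<^sup>2 / 2 * (x $ k)\<^sup>2\<bar> \<le> (h * x $ k) ^ 4"
          using abs_cos_approx[of "h * x $ k"] by (simp add: power_mult_distrib)
        also have "\<dots> \<le> h ^ 4 * (norm x) ^ 4"
          unfolding power_mult_distrib
          using power_mono[OF component_le_norm_cart[of x k], of 4] by (intro mult_left_mono) auto
        finally show "\<bar>(cos (h * x $ k) - 1) + h\<^sup>2 / 2 * (x $ k)\<^sup>2\<bar> \<le> h ^ 4 * (norm x) ^ 4" .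
      qed (use intA int2 integrable_power4 in auto)
      also have "\<dots> \<le> c * h ^ 4"
        by (simp add: c_def mult.commute mult_left_mono)
      finally show ?thesis .
    qed
    moreover have "\<bar>B - \<alpha> $ k * h\<bar> \<le> c * \<bar>h\<bar> ^ 3"
    proof -
      have "\<bar>B - \<alpha> $ k * h\<bar> \<le> (\<integral>x. \<bar>sin (h * x $ k) - h * x $ k\<bar> \<partial>\<nu>)"
        unfolding B_def using integral_abs_bound[of \<nu> "\<lambda>x. sin (h * x $ k) - h * x $ k"] by (simp add: mult.commute)
      also have "\<dots> \<le> (\<integral>x. \<bar>h\<bar> ^ 3 * (norm x) ^ 3 \<partial>\<nu>)"
      proof (rule integral_mono)
        fix x :: "real ^ 'd"
        have "\<bar>sin (h * x $ k) - h * x $ k\<bar> \<le> \<bar>h\<bar> ^ 3 * \<bar>x $ k\<bar> ^ 3"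
          using abs_sin_approx[of "h * x $ k"] by (simp add: abs_mult power_mult_distrib)
        also have "\<dots> \<le> \<bar>h\<bar> ^ 3 * (norm x) ^ 3"
          using power_mono[OF component_le_norm_cart[of x k], of 3] by (intro mult_left_mono) auto
        finally show "\<bar>sin (h * x $ k) - h * x $ k\<bar> \<le> \<bar>h\<bar> ^ 3 * (norm x) ^ 3" .
      qed (use intB integrable_power3 in auto)
      also have "\<dots> \<le> c * \<bar>h\<bar> ^ 3"
        by (simp add: c_def mult.commute mult_left_mono)
      finally show ?thesis .
    qed
    ultimately show ?thesis
      unfolding K_def C_def D_def u_def[symmetric] using exp_mult_cos_expansion[of A b h c B "\<alpha> $ k"] b c h by simp
  qed
  ultimately show ?thesis
    by (rule that)
qed

text \<open>Fatou's lemma applied to the fourth symmetric difference of the characteristic function.\<close>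

lemma integrable_component_power4:
  assumes P: "prob_space P" and sets[measurable_cong]: "sets P = sets borel"
    and cf: "\<And>u. (CLINT x|P. iexp (u \<bullet> x)) = levy_cf \<nu> \<alpha> u"
  shows "integrable P (\<lambda>x. (x $ k) ^ 4)"
proof (rule integrableI_nonneg)
  interpret prob_space P by fact
  obtain q K where K: "0 \<le> K"
    "\<And>h. \<bar>h\<bar> \<le> 1 \<Longrightarrow> \<bar>Re (levy_cf \<nu> \<alpha> (h *\<^sub>R axis k 1)) - (1 - q * h\<^sup>2)\<bar> \<le> K * h ^ 4"
    using Re_levy_cf_expansion[of \<alpha> k] by metis
  have int_cos: "integrable P (\<lambda>x. cos (h * x $ k))" for h
    by (rule integrable_const_bound[where B = 1]) auto
  have E_cos: "(\<integral>x. cos (h * x $ k) \<partial>P) = Re (levy_cf \<nu> \<alpha> (h *\<^sub>R axis k 1))" for h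
    using integral_Re[OF integrable_iexp_inner[OF finite_measure_axioms sets, of "h *\<^sub>R axis k 1"]]
    unfolding cf by (simp add: Re_exp inner_axis')
  \<comment> \<open>With h = 1 / (n + 2) this is |1 - exp (i h x_k)|^4 / h^4, which tends to x_k^4.
    The offset 2 ensures 2 h \<le> 1, as the expansion is used at \<open>h\<close> and at 2
    h.\<close>
  define g where "g n x = ((2 - 2 * cos (x $ k / real (n + 2))) * (real (n + 2))\<^sup>2)\<^sup>2" for n and x :: "real ^ 'd"
  have g_int: "integrable P (g n)" and g_le: "(\<integral>x. g n x \<partial>P) \<le> 40 * K" for n
  proof -
    define h where "h = 1 / real (n + 2)"
    have h: "0 < h" "\<bar>2 * h\<bar> \<le> 1"
      by (simp_all add: h_def)
    have g: "g n x = (6 - 8 * cos (h * x $ k) + 2 * cos ((2 * h) * x $ k)) / h ^ 4" for x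
    proof -
      have "cos ((2 * h) * x $ k) = 2 * (cos (h * x $ k))\<^sup>2 - 1"
        using cos_double_cos[of "h * x $ k"] by (simp add: mult_ac)
      then have "6 - 8 * cos (h * x $ k) + 2 * cos ((2 * h) * x $ k) = (2 - 2 * cos (h * x $ k))\<^sup>2"
        by (simp add: power2_eq_square algebra_simps)
      moreover have "real (n + 2) ^ 4 = 1 / h ^ 4"
        by (simp add: h_def power_one_over)
      ultimately show ?thesis
        by (simp add: g_def h_def power_mult_distrib mult.commute[of _ "_ / _"])
    qed
    show "integrable P (g n)"
      unfolding g using int_cos by auto
    have "(\<integral>x. g n x \<partial>P) = (6 - 8 * (\<integral>x. cos (h * x $ k) \<partial>P) + 2 * (\<integral>x. cos ((2 * h) * x $ k) \<partial>P)) / h ^ 4"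
      unfolding g using int_cos[of h] int_cos[of "2 * h"] by (simp add: prob_space)
    also have "\<dots> \<le> (40 * K * h ^ 4) / h ^ 4"
    proof (rule divide_right_mono)
      \<comment> \<open>The coefficients 6, -8, 2 annihilate the constant and the quadratic terms: 6
        - 8 + 2 = 0 and 8 q - 2 * 4 q = 0. What remains is 8 K h^4 + 2 * 16 K h^4, hence 40.\<close>
      have "(2 * h)\<^sup>2 = 4 * h\<^sup>2" "(2 * h) ^ 4 = 16 * h ^ 4"
        by (simp_all add: power_mult_distrib)
      then show "6 - 8 * (\<integral>x. cos (h * x $ k) \<partial>P) + 2 * (\<integral>x. cos ((2 * h) * x $ k) \<partial>P) \<le> 40 * K * h ^ 4"
        using K(2)[of h] K(2)[of "2 * h"] h unfolding E_cos by (simp add: abs_le_iff)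
    qed simp
    finally show "(\<integral>x. g n x \<partial>P) \<le> 40 * K"
      using h by simp
  qed
  have g_lim: "(\<lambda>n. g n x) \<longlonglongrightarrow> (x $ k) ^ 4" for x
  proof -
    have "(\<lambda>n. (2 - 2 * cos (x $ k / real (n + 2))) * (real (n + 2))\<^sup>2) \<longlonglongrightarrow> (x $ k)\<^sup>2"
    proof (rule LIM_zero_cancel, rule Lim_null_comparison)
      show "eventually (\<lambda>n. norm ((2 - 2 * cos (x $ k / real (n + 2))) * (real (n + 2))\<^sup>2 - (x $ k)\<^sup>2)
          \<le> 2 * (x $ k) ^ 4 * (inverse (real (Suc n)))\<^sup>2) sequentially"
      proof (intro always_eventually allI)
        fix n
        define m where "m = real (n + 2)"
        have m: "0 < m" "inverse m \<le> inverse (real (Suc n))"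
          by (auto simp: m_def)
        define y where "y = x $ k / m"
        have "(2 - 2 * cos y) * m\<^sup>2 - (x $ k)\<^sup>2 = - 2 * m\<^sup>2 * (cos y - (1 - y\<^sup>2 / 2))"
          using m by (simp add: y_def field_simps)
        then have "\<bar>(2 - 2 * cos y) * m\<^sup>2 - (x $ k)\<^sup>2\<bar> = \<bar>- 2 * m\<^sup>2 * (cos y - (1 - y\<^sup>2 / 2))\<bar>"
          by (rule arg_cong)
        also have "\<dots> \<le> 2 * m\<^sup>2 * y ^ 4"
          unfolding abs_mult using abs_cos_approx[of y] by (intro mult_mono) auto
        also have "\<dots> = 2 * (x $ k) ^ 4 * (inverse m)\<^sup>2"
          using m by (simp add: y_def field_simps eval_nat_numeral)
        also have "\<dots> \<le> 2 * (x $ k) ^ 4 * (inverse (real (Suc n)))\<^sup>2"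
          using m by (intro mult_left_mono power_mono) auto
        finally show "norm ((2 - 2 * cos (x $ k / real (n + 2))) * (real (n + 2))\<^sup>2 - (x $ k)\<^sup>2)
          \<le> 2 * (x $ k) ^ 4 * (inverse (real (Suc n)))\<^sup>2"
          unfolding y_def m_def real_norm_def .
      qed
      have "(\<lambda>n. 2 * (x $ k) ^ 4 * (inverse (real (Suc n)))\<^sup>2) \<longlonglongrightarrow> 2 * (x $ k) ^ 4 * 0\<^sup>2"
        by (intro tendsto_mult tendsto_const tendsto_power LIMSEQ_inverse_real_of_nat)
      then show "(\<lambda>n. 2 * (x $ k) ^ 4 * (inverse (real (Suc n)))\<^sup>2) \<longlonglongrightarrow> 0"
        by simp
    qed
    from tendsto_power[OF this, of 2] show ?thesis
      unfolding g_def by (simp add: power_mult[symmetric])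
  qed
  have "(\<integral>\<^sup>+x. ennreal ((x $ k) ^ 4) \<partial>P) = (\<integral>\<^sup>+x. liminf (\<lambda>n. ennreal (g n x)) \<partial>P)"
    by (intro nn_integral_cong lim_imp_Liminf[symmetric] tendsto_ennrealI g_lim) simp
  also have "\<dots> \<le> liminf (\<lambda>n. \<integral>\<^sup>+x. ennreal (g n x) \<partial>P)"
    using g_int by (intro nn_integral_liminf) auto
  also have "\<dots> \<le> ennreal (40 * K)"
  proof (intro Liminf_le always_eventually allI)
    fix n
    have "0 \<le> g n x" for x
      by (simp add: g_def)
    then show "(\<integral>\<^sup>+x. ennreal (g n x) \<partial>P) \<le> ennreal (40 * K)"
      using g_int[of n] g_le[of n] by (simp add: nn_integral_eq_integral ennreal_leI)
  qed simp
  finally show "(\<integral>\<^sup>+x. ennreal ((x $ k) ^ 4) \<partial>P) < \<infinity>"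
    using le_less_trans by fastforce
qed simp_all

end

section \<open>Consistency of minimum distance estimators\<close>

lemma weighted_sup_norm_tendsto_0I:
  assumes "\<And>e. 0 < e \<Longrightarrow> \<forall>\<^sub>F n in sequentially. \<forall>u. w u * norm (\<psi> n u) \<le> e"
  shows "(\<lambda>n. weighted_sup_norm w (\<psi> n)) \<longlonglongrightarrow> 0"
proof (rule order_tendstoI)
  fix a :: ennreal assume "0 < a"
  then obtain b where b: "0 < b" "b < a"
    using dense by blast
  obtain r where r: "b = ennreal r" "0 \<le> r"
    using b(2) by (cases b) auto
  then have "0 < r"
    using b(1) by (cases "r = 0") auto
  from assms[OF this] show "\<forall>\<^sub>F n in sequentially. weighted_sup_norm w (\<psi> n) < a"
  proof eventually_elim
    case (elim n)
    then have "weighted_sup_norm w (\<psi> n) \<le> b"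
      unfolding weighted_sup_norm_def r(1) by (auto intro!: SUP_least ennreal_leI)
    then show ?case
      using b(2) by simp
  qed
qed simp

lemma weighted_sup_norm_tendsto_0D:
  assumes "(\<lambda>n. weighted_sup_norm w (\<psi> n)) \<longlonglongrightarrow> 0" "0 < w u"
  shows "(\<lambda>n. \<psi> n u) \<longlonglongrightarrow> 0"
proof -
  have "ennreal (w u * norm (\<psi> n u)) \<le> weighted_sup_norm w (\<psi> n)" for n
    unfolding weighted_sup_norm_def by (rule SUP_upper) simp
  then have "(\<lambda>n. ennreal (w u * norm (\<psi> n u))) \<longlonglongrightarrow> 0"
    by (intro tendsto_sandwich[OF _ _ tendsto_const assms(1)]) auto
  then have "(\<lambda>n. ennreal (w u * norm (\<psi> n u))) \<longlonglongrightarrow> ennreal 0"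
    by simp
  then have "(\<lambda>n. w u * norm (\<psi> n u)) \<longlonglongrightarrow> 0"
    using assms(2) by (subst (asm) tendsto_ennreal_iff) auto
  then have "(\<lambda>n. inverse (w u) * (w u * norm (\<psi> n u))) \<longlonglongrightarrow> inverse (w u) * 0"
    by (intro tendsto_mult tendsto_const)
  then show ?thesis
    using assms(2) by (simp add: mult.assoc[symmetric] tendsto_norm_zero_iff)
qed

lemma dist2_eq:
  assumes "\<And>k. has_partial_deriv k f (f1 k)" "\<And>k. has_partial_deriv k (f1 k) (f2 k)"
    and "\<And>k. has_partial_deriv k g (g1 k)" "\<And>k. has_partial_deriv k (g1 k) (g2 k)"
  shows "dist2 w f g = weighted_sup_norm w (\<lambda>u. f u - g u)
    + (\<Sum>k\<in>UNIV. weighted_sup_norm w (\<lambda>u. f1 k u - g1 k u))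
    + (\<Sum>k\<in>UNIV. weighted_sup_norm w (\<lambda>u. f2 k u - g2 k u))"
proof -
  have 1: "partial_deriv k (\<lambda>u. f u - g u) = (\<lambda>u. f1 k u - g1 k u)"
    and 2: "partial_deriv k (\<lambda>u. f1 k u - g1 k u) = (\<lambda>u. f2 k u - g2 k u)" for k
    by (intro partial_deriv_eqI has_partial_deriv_diff assms)+
  show ?thesis
    unfolding dist2_def Let_def 1 2 ..
qed

lemma dist2_tendsto_0I:
  assumes f: "\<And>n k. has_partial_deriv k (f n) (f1 n k)" "\<And>n k. has_partial_deriv k (f1 n k) (f2 n k)"
    and g: "\<And>n k. has_partial_deriv k (g n) (g1 n k)" "\<And>n k. has_partial_deriv k (g1 n k) (g2 n k)"
    and "(\<lambda>n. weighted_sup_norm w (\<lambda>u. f n u - g n u)) \<longlonglongrightarrow> 0"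
    and "\<And>k. (\<lambda>n. weighted_sup_norm w (\<lambda>u. f1 n k u - g1 n k u)) \<longlonglongrightarrow> 0"
    and "\<And>k. (\<lambda>n. weighted_sup_norm w (\<lambda>u. f2 n k u - g2 n k u)) \<longlonglongrightarrow> 0"
  shows "(\<lambda>n. dist2 w (f n) (g n)) \<longlonglongrightarrow> 0"
proof -
  have "(\<lambda>n. dist2 w (f n) (g n)) \<longlonglongrightarrow> 0 + (\<Sum>k\<in>(UNIV :: 'a set). 0) + (\<Sum>k\<in>(UNIV :: 'a set). 0)"
    unfolding dist2_eq[OF f g] by (intro tendsto_add tendsto_sum assms)
  then show ?thesis by simp
qed

text \<open>Each summand of \<open>dist2\<close> is squeezed between 0 and the whole, and the
  positive weight at \<open>u\<close> can be divided out. Pointwise convergence is all that the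
  continuity theorem asks for.\<close>

lemma dist2_tendsto_0D:
  assumes f: "\<And>n k. has_partial_deriv k (f n) (f1 n k)" "\<And>n k. has_partial_deriv k (f1 n k) (f2 n k)"
    and g: "\<And>n k. has_partial_deriv k (g n) (g1 n k)" "\<And>n k. has_partial_deriv k (g1 n k) (g2 n k)"
    and lim: "(\<lambda>n. dist2 w (f n) (g n)) \<longlonglongrightarrow> 0" and w: "0 < w u"
  shows "(\<lambda>n. f n u - g n u) \<longlonglongrightarrow> 0"
    and "(\<lambda>n. f1 n k u - g1 n k u) \<longlonglongrightarrow> 0"
    and "(\<lambda>n. f2 n k u - g2 n k u) \<longlonglongrightarrow> 0"
proof -
  have le: "weighted_sup_norm w (\<lambda>u. f n u - g n u) \<le> dist2 w (f n) (g n)"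
    "weighted_sup_norm w (\<lambda>u. f1 n k u - g1 n k u) \<le> dist2 w (f n) (g n)"
    "weighted_sup_norm w (\<lambda>u. f2 n k u - g2 n k u) \<le> dist2 w (f n) (g n)" for n
  proof -
    have m: "h k \<le> (\<Sum>k\<in>UNIV. h k)" for h :: "'a \<Rightarrow> ennreal"
      by (rule member_le_sum) auto
    have add: "a \<le> a + b + c" "b \<le> a + b + c" "c \<le> a + b + c" for a b c :: ennreal
      by (auto intro: add_increasing add_increasing2)
    show "weighted_sup_norm w (\<lambda>u. f n u - g n u) \<le> dist2 w (f n) (g n)"
      "weighted_sup_norm w (\<lambda>u. f1 n k u - g1 n k u) \<le> dist2 w (f n) (g n)"
      "weighted_sup_norm w (\<lambda>u. f2 n k u - g2 n k u) \<le> dist2 w (f n) (g n)"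
      unfolding dist2_eq[OF f g] by (rule add(1) order_trans[OF m add(2)] order_trans[OF m add(3)])+
  qed
  have sq: "\<psi> \<longlonglongrightarrow> 0" if "\<And>n. \<psi> n \<le> dist2 w (f n) (g n)" for \<psi> :: "nat \<Rightarrow> ennreal"
    by (rule tendsto_sandwich[OF _ _ tendsto_const lim]) (use that in auto)
  show "(\<lambda>n. f n u - g n u) \<longlonglongrightarrow> 0" "(\<lambda>n. f1 n k u - g1 n k u) \<longlonglongrightarrow> 0" "(\<lambda>n. f2 n k u - g2 n k u) \<longlonglongrightarrow> 0"
    using weighted_sup_norm_tendsto_0D[where \<psi> = "\<lambda>n u. f n u - g n u", OF sq[OF le(1)] w]
      weighted_sup_norm_tendsto_0D[where \<psi> = "\<lambda>n u. f1 n k u - g1 n k u", OF sq[OF le(2)] w]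
      weighted_sup_norm_tendsto_0D[where \<psi> = "\<lambda>n u. f2 n k u - g2 n k u", OF sq[OF le(3)] w] .
qed

lemma has_partial_deriv_empirical:
  fixes y :: "nat \<Rightarrow> real ^ 'd" and h :: "real ^ 'd \<Rightarrow> complex"
  shows "has_partial_deriv k (\<lambda>u. (\<Sum>i<n. h (y i) * iexp (u \<bullet> y i)) / of_nat n)
    (\<lambda>u. (\<Sum>i<n. \<i> * of_real (y i $ k) * h (y i) * iexp (u \<bullet> y i)) / of_nat n)"
  unfolding has_partial_deriv_def
proof
  fix u :: "real ^ 'd"
  have "((\<lambda>s. h (y i) * iexp ((u + s *\<^sub>R axis k 1) \<bullet> y i)) has_vector_derivative
      \<i> * of_real (y i $ k) * h (y i) * iexp (u \<bullet> y i)) (at 0)" for i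
    using has_vector_derivative_mult_right[OF has_vector_derivative_iexp_line[of u "axis k 1" "y i" 0], of "h (y i)"]
    by (simp add: inner_axis' mult_ac)
  then show "((\<lambda>s. (\<Sum>i<n. h (y i) * iexp ((u + s *\<^sub>R axis k 1) \<bullet> y i)) / of_nat n) has_vector_derivative
      (\<Sum>i<n. \<i> * of_real (y i $ k) * h (y i) * iexp (u \<bullet> y i)) / of_nat n) (at 0)"
    by (intro has_vector_derivative_divide has_vector_derivative_sum)
qed

lemma empirical_cf_eq:
  assumes "\<And>i. y i = (x(0 := 0)) (Suc i) - (x(0 := 0)) i"
  shows "empirical_cf n x u = (\<Sum>i<n. 1 * iexp (u \<bullet> y i)) / of_nat n"
proof -
  have "(\<Sum>t=1..n. iexp (u \<bullet> ((x(0 := 0)) t - (x(0 := 0)) (t - 1)))) = (\<Sum>i<n. iexp (u \<bullet> y i))"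
    unfolding assms by (rule sum.reindex_bij_witness[of _ Suc "\<lambda>t. t - 1"]) auto
  then show ?thesis
    by (simp add: empirical_cf_def)
qed

text \<open>Dividing by the zero-free \<open>levy_cf\<close> isolates the second derivatives of the
  exponents, in which no drift occurs; the weak limit is thus found without first identifying a
  limit of the drifts.\<close>

lemma levy_cf_tendsto_imp_weak_convergence:
  fixes \<nu> :: "(real ^ 'd) measure" and \<nu>' :: "nat \<Rightarrow> (real ^ 'd) measure"
  assumes \<nu>: "levy_moment4 \<nu>" and \<nu>': "\<And>n. levy_moment4 (\<nu>' n)"
    and c0: "\<And>u. (\<lambda>n. levy_cf (\<nu>' n) (\<alpha>' n) u) \<longlonglongrightarrow> levy_cf \<nu> \<alpha> u"
    and c1: "\<And>k u. (\<lambda>n. levy_cf (\<nu>' n) (\<alpha>' n) u * levy_moment4.cumulant1 (\<nu>' n) (\<alpha>' n) k u)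
      \<longlonglongrightarrow> levy_cf \<nu> \<alpha> u * levy_moment4.cumulant1 \<nu> \<alpha> k u"
    and c2: "\<And>k u. (\<lambda>n. levy_cf (\<nu>' n) (\<alpha>' n) u *
        ((levy_moment4.cumulant1 (\<nu>' n) (\<alpha>' n) k u)\<^sup>2 + levy_moment4.cumulant2 (\<nu>' n) k u))
      \<longlonglongrightarrow> levy_cf \<nu> \<alpha> u * ((levy_moment4.cumulant1 \<nu> \<alpha> k u)\<^sup>2 + levy_moment4.cumulant2 \<nu> k u)"
    and f: "continuous_on UNIV f" "bounded (range f)"
  shows "(\<lambda>n. \<integral>x. f x * (norm x)\<^sup>2 \<partial>\<nu>' n) \<longlonglongrightarrow> (\<integral>x. f x * (norm x)\<^sup>2 \<partial>\<nu>)"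
proof -
  define \<mu> where "\<mu> N = density N (\<lambda>x. ennreal ((norm x)\<^sup>2))" for N :: "(real ^ 'd) measure"
  have nz: "levy_cf N a u \<noteq> 0" for N :: "(real ^ 'd) measure" and a u
    by (simp add: levy_cf_def)
  have int_\<mu>: "(\<integral>x. g x \<partial>\<mu> N) = (\<integral>x. (norm x)\<^sup>2 *\<^sub>R g x \<partial>N)"
    if "levy_moment4 N" and [measurable]: "g \<in> borel_measurable borel"
    for N and g :: "real ^ 'd \<Rightarrow> 'b::{banach, second_countable_topology}"
  proof -
    note [measurable_cong] = levy_moment4.sets_eq[OF that(1)]
    show ?thesis
      unfolding \<mu>_def by (rule integral_density) auto
  qed
  have cf_\<mu>: "(CLINT x|\<mu> N. iexp (u \<bullet> x)) = - (\<Sum>k\<in>UNIV. levy_moment4.cumulant2 N k u)"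
    if "levy_moment4 N" for N u
    by (simp add: int_\<mu>[OF that] levy_moment4.sum_cumulant2[OF that] scaleR_conv_of_real)
  have "(\<lambda>n. levy_moment4.cumulant2 (\<nu>' n) k u) \<longlonglongrightarrow> levy_moment4.cumulant2 \<nu> k u" for k u
  proof -
    have log_deriv: "(z * ((c::complex)\<^sup>2 + b)) / z - ((z * c) / z)\<^sup>2 = b" if "z \<noteq> 0" for z c b
      using that by simp
    have "(\<lambda>n. (levy_cf (\<nu>' n) (\<alpha>' n) u *
          ((levy_moment4.cumulant1 (\<nu>' n) (\<alpha>' n) k u)\<^sup>2 + levy_moment4.cumulant2 (\<nu>' n) k u)) / levy_cf (\<nu>' n) (\<alpha>' n) u
        - ((levy_cf (\<nu>' n) (\<alpha>' n) u * levy_moment4.cumulant1 (\<nu>' n) (\<alpha>' n) k u) / levy_cf (\<nu>' n) (\<alpha>' n) u)\<^sup>2)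
      \<longlonglongrightarrow> (levy_cf \<nu> \<alpha> u * ((levy_moment4.cumulant1 \<nu> \<alpha> k u)\<^sup>2 + levy_moment4.cumulant2 \<nu> k u)) / levy_cf \<nu> \<alpha> u
        - ((levy_cf \<nu> \<alpha> u * levy_moment4.cumulant1 \<nu> \<alpha> k u) / levy_cf \<nu> \<alpha> u)\<^sup>2"
      by (intro tendsto_diff tendsto_divide tendsto_power c0 c1 c2 nz)
    then show ?thesis
      unfolding log_deriv[OF nz] .
  qed
  then have "(\<lambda>n. CLINT x|\<mu> (\<nu>' n). iexp (u \<bullet> x)) \<longlonglongrightarrow> (CLINT x|\<mu> \<nu>. iexp (u \<bullet> x))" for u
    unfolding cf_\<mu>[OF \<nu>] cf_\<mu>[OF \<nu>'] by (intro tendsto_minus tendsto_sum)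
  then have "(\<lambda>n. \<integral>x. f x \<partial>\<mu> (\<nu>' n)) \<longlonglongrightarrow> (\<integral>x. f x \<partial>\<mu> \<nu>)"
    using \<nu> \<nu>' f
    by (intro finite_measure_levy_continuity) (auto simp: \<mu>_def levy_moment4.finite_measure_density levy_moment4.sets_eq)
  moreover have "f \<in> borel_measurable borel"
    by (rule borel_measurable_continuous_onI[OF f(1)])
  ultimately show ?thesis
    by (simp add: int_\<mu>[OF \<nu>] int_\<mu>[OF \<nu>'] mult.commute)
qed

theorem theorem2p4:
  fixes M :: "'w measure"
    and X :: "real \<Rightarrow> 'w \<Rightarrow> real ^ 'd"
    and \<Sigma> :: "real ^ 'd ^ 'd"
    and \<nu> :: "(real ^ 'd) measure"
    and \<alpha> :: "real ^ 'd"
    and w :: "real ^ 'd \<Rightarrow> real"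
    and \<delta> :: "nat \<Rightarrow> real"
    and \<nu>_hat :: "nat \<Rightarrow> 'w \<Rightarrow> (real ^ 'd) measure"
    and \<alpha>_hat :: "nat \<Rightarrow> 'w \<Rightarrow> real ^ 'd"
  assumes "levy_process M X"
    and "has_levy_triplet M X \<Sigma> \<nu> \<alpha>"
    and "\<Sigma> = 0"
    and "(\<integral>\<^sup>+ x. ennreal ((norm x) ^ 4) \<partial>\<nu>) < \<infinity>"
    and "continuous_on UNIV w"
    and "\<And>u. 0 < w u"
    and "(w \<longlongrightarrow> 0) at_infinity"
    and "\<And>n. n \<ge> 1 \<Longrightarrow> 0 < \<delta> n"
    and "antimono_on {1..} \<delta>"
    and "\<delta> \<longlonglongrightarrow> 0"
    and "\<And>n \<omega>. n \<ge> 1 \<Longrightarrow> \<omega> \<in> space M \<Longrightarrow>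
           min_distance_estimate w (\<delta> n) n (\<lambda>t. X (real t) \<omega>) (\<nu>_hat n \<omega>) (\<alpha>_hat n \<omega>)"
  shows "AE \<omega> in M.
           finite_measure (density \<nu> (\<lambda>x. ennreal ((norm x)\<^sup>2))) \<and>
           (\<forall>n\<ge>1. finite_measure (density (\<nu>_hat n \<omega>) (\<lambda>x. ennreal ((norm x)\<^sup>2)))) \<and>
           (\<forall>f :: real ^ 'd \<Rightarrow> real. continuous_on UNIV f \<longrightarrow> bounded (range f) \<longrightarrow>
              (\<lambda>n. \<integral>x. f x * (norm x)\<^sup>2 \<partial>(\<nu>_hat n \<omega>))
                \<longlonglongrightarrow> (\<integral>x. f x * (norm x)\<^sup>2 \<partial>\<nu>))"
proof -
  note X = assms(1)[unfolded levy_process_def]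
  note trip = assms(2)[unfolded has_levy_triplet_def]
  interpret M: prob_space M
    by (rule X[THEN conjunct1])
  interpret \<nu>: levy_moment4 \<nu>
    using trip[THEN conjunct2, THEN conjunct2, THEN conjunct1] assms(4)
    by unfold_locales (simp add: levy_measure4_def)
  have X_meas[measurable]: "X t \<in> borel_measurable M" if "0 \<le> t" for t
    using X[THEN conjunct2, THEN conjunct1] that by blast
  have X0: "AE \<omega> in M. X 0 \<omega> = 0"
    by (rule X[THEN conjunct2, THEN conjunct2, THEN conjunct1])
  define Y where "Y i \<omega> = X (real (Suc i)) \<omega> - X (real i) \<omega>" for i \<omega>
  define P where "P = distr M borel (Y 0)"
  have Y_meas[measurable]: "Y i \<in> borel_measurable M" for i
    unfolding Y_def by measurable
  have indep: "M.indep_vars (\<lambda>_. borel) Y {..<n}" for n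
  proof -
    note X[THEN conjunct2, THEN conjunct2, THEN conjunct2, THEN conjunct1]
    \<comment> \<open>The sampling times t_i = i are the embedding \<open>real\<close>
      itself.\<close>
    from this[rule_format, of real n] show ?thesis
      unfolding Y_def[abs_def] by simp
  qed
  have distr: "distr M borel (Y i) = P" for i
  proof -
    note st = X[THEN conjunct2, THEN conjunct2, THEN conjunct2, THEN conjunct2, THEN conjunct1]
    show ?thesis
      unfolding P_def Y_def[abs_def] using st[rule_format, of "real i" 1] by (simp add: add.commute)
  qed
  have P: "prob_space P" and sets_P[measurable_cong]: "sets P = sets borel"
    unfolding P_def by (auto intro: M.prob_space_distr)
  interpret P: prob_space P by (rule P)
  have cf: "(CLINT x|P. iexp (u \<bullet> x)) = levy_cf \<nu> \<alpha> u" for u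
  proof -
    have "(CLINT x|P. iexp (u \<bullet> x)) = (CLINT \<omega>|M. iexp (u \<bullet> Y 0 \<omega>))"
      unfolding P_def by (rule integral_distr) auto
    also have "\<dots> = (CLINT \<omega>|M. iexp (u \<bullet> X 1 \<omega>))"
      \<comment> \<open>\<open>Y 0\<close> is X 1 - X 0 and agrees with \<open>X 1\<close> only
        almost surely.\<close>
      using X0 by (intro integral_cong_AE) (auto simp: Y_def)
    also have "\<dots> = levy_cf \<nu> \<alpha> u"
      using trip[THEN conjunct2, THEN conjunct2, THEN conjunct2, THEN conjunct2] assms(3) by simp
    finally show ?thesis .
  qed
  have mom4: "integrable P (\<lambda>x. (x $ k) ^ 4)" for k
    by (rule \<nu>.integrable_component_power4[OF P sets_P cf])
  have mom2: "integrable P (\<lambda>x. (x $ k)\<^sup>2)" for k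
    by (rule P.square_integrable_imp_integrable) (use mom4[of k] in \<open>simp_all add: power_mult[symmetric]\<close>)
  have mom1: "integrable P (\<lambda>x. x $ k)" for k
    by (rule P.square_integrable_imp_integrable) (use mom2[of k] in simp_all)
  \<comment> \<open>The multipliers produced by differentiating iexp (u \<bullet> x) once and twice
    in direction k. They are the same under \<open>P\<close> and under the empirical mean, so the
    derivatives of the error are again empirical averages minus expectations, and one uniform law
    covers all three orders.\<close>
  define h1 :: "'d \<Rightarrow> real ^ 'd \<Rightarrow> complex" where "h1 k x = \<i> * of_real (x $ k)" for k x
  define h2 :: "'d \<Rightarrow> real ^ 'd \<Rightarrow> complex" where "h2 k x = \<i> * of_real (x $ k) * (\<i> * of_real (x $ k))" for k x
  have [measurable]: "h1 k \<in> borel_measurable borel" "h2 k \<in> borel_measurable borel" for k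
    unfolding h1_def h2_def by measurable
  have nh: "(norm (h1 k x))\<^sup>2 = (x $ k)\<^sup>2" "(norm (h2 k x))\<^sup>2 = (x $ k) ^ 4" for k x
    by (simp_all add: h1_def h2_def norm_mult power_mult_distrib eval_nat_numeral)
  define E where "E h = (\<lambda>u. CLINT x|P. h x * iexp (u \<bullet> x))" for h :: "real ^ 'd \<Rightarrow> complex"
  define A where "A n \<omega> h = (\<lambda>u. (\<Sum>i<n. h (Y i \<omega>) * iexp (u \<bullet> Y i \<omega>)) / of_nat n)"
    for n \<omega> and h :: "real ^ 'd \<Rightarrow> complex"
  have E0: "E (\<lambda>_. 1) = levy_cf \<nu> \<alpha>"
    by (simp add: E_def cf fun_eq_iff)
  have dE1: "has_partial_deriv k (E (\<lambda>_. 1)) (E (h1 k))" for k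
    unfolding E_def
    using has_partial_deriv_integral_iexp[OF sets_P, of "\<lambda>_. 1" 0 k] mom1[of k]
      integrable_iexp_inner[OF P.finite_measure_axioms sets_P]
    by (simp add: h1_def)
  have dE2: "has_partial_deriv k (E (h1 k)) (E (h2 k))" for k
  proof -
    have "integrable P (\<lambda>x. h1 k x * (iexp (u \<bullet> x) - 0))" for u
      by (rule Bochner_Integration.integrable_bound[OF mom1[of k]]) (auto simp: h1_def norm_mult)
    moreover have "integrable P (\<lambda>x. norm (h1 k x) * \<bar>x $ k\<bar>)"
      using mom2[of k] by (simp add: h1_def norm_mult power2_eq_square)
    ultimately show ?thesis
      unfolding E_def using has_partial_deriv_integral_iexp[OF sets_P, of "h1 k" 0 k] by (simp add: h1_def h2_def)
  qed
  have dA1: "has_partial_deriv k (A n \<omega> (\<lambda>_. 1)) (A n \<omega> (h1 k))" for k n \<omega>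
    unfolding A_def using has_partial_deriv_empirical[of k "\<lambda>_. 1" "\<lambda>i. Y i \<omega>" n] by (simp add: h1_def)
  have dA2: "has_partial_deriv k (A n \<omega> (h1 k)) (A n \<omega> (h2 k))" for k n \<omega>
    unfolding A_def using has_partial_deriv_empirical[of k "h1 k" "\<lambda>i. Y i \<omega>" n] by (simp add: h1_def h2_def)
  have lln: "AE \<omega> in M. (\<lambda>n. weighted_sup_norm w (\<lambda>u. A n \<omega> h u - E h u)) \<longlonglongrightarrow> 0"
    if "h \<in> borel_measurable borel" "integrable P (\<lambda>x. (norm (h x))\<^sup>2)" for h
    using M.weighted_uniform_strong_law[OF indep distr that assms(5,7) less_imp_le[OF assms(6)]]
  proof eventually_elim
    case (elim \<omega>)
    show ?case
      by (rule weighted_sup_norm_tendsto_0I) (use elim in \<open>simp add: A_def E_def\<close>)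
  qed
  have "AE \<omega> in M. (\<lambda>n. weighted_sup_norm w (\<lambda>u. A n \<omega> (\<lambda>_. 1) u - E (\<lambda>_. 1) u)) \<longlonglongrightarrow> 0"
    by (rule lln) auto
  moreover have "AE \<omega> in M. \<forall>k. (\<lambda>n. weighted_sup_norm w (\<lambda>u. A n \<omega> (h1 k) u - E (h1 k) u)) \<longlonglongrightarrow> 0"
    unfolding AE_all_countable by (intro allI lln) (auto simp: nh mom2)
  moreover have "AE \<omega> in M. \<forall>k. (\<lambda>n. weighted_sup_norm w (\<lambda>u. A n \<omega> (h2 k) u - E (h2 k) u)) \<longlonglongrightarrow> 0"
    unfolding AE_all_countable by (intro allI lln) (auto simp: nh mom4)
  ultimately show ?thesis
    using X0 AE_space
  proof eventually_elim
    case (elim \<omega>)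
    have est: "min_distance_estimate w (\<delta> (Suc n)) (Suc n) (\<lambda>t. X (real t) \<omega>) (\<nu>_hat (Suc n) \<omega>) (\<alpha>_hat (Suc n) \<omega>)" for n
      using assms(11)[of "Suc n" \<omega>] elim(5) by simp
    have lm: "levy_moment4 (\<nu>_hat n \<omega>)" if "1 \<le> n" for n
      using assms(11)[OF that elim(5)] by unfold_locales (simp add: min_distance_estimate_def)
    \<comment> \<open>\<open>empirical_cf\<close> replaces the observation at time 0 by 0, whereas
      \<open>Y 0\<close> uses the actual value; the two agree because X 0 \<omega> = 0 on the event
      under consideration.\<close>
    have emp: "empirical_cf n (\<lambda>t. X (real t) \<omega>) = A n \<omega> (\<lambda>_. 1)" for n
    proof -
      have "Y i \<omega> = ((\<lambda>t. X (real t) \<omega>)(0 := 0)) (Suc i) - ((\<lambda>t. X (real t) \<omega>)(0 := 0)) i" for i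
        using elim(4) by (cases i) (simp_all add: Y_def)
      then show ?thesis
        unfolding A_def by (intro ext) (rule empirical_cf_eq)
    qed
    \<comment> \<open>All sequences are shifted to start at sample size 1, so that the properties of
      the estimates hold for every index.\<close>
    define F where "F n = A (Suc n) \<omega> (\<lambda>_. 1)" for n
    define F1 where "F1 n k = A (Suc n) \<omega> (h1 k)" for n k
    define F2 where "F2 n k = A (Suc n) \<omega> (h2 k)" for n k
    define \<nu>' where "\<nu>' n = \<nu>_hat (Suc n) \<omega>" for n
    define \<alpha>' where "\<alpha>' n = \<alpha>_hat (Suc n) \<omega>" for n
    have \<nu>': "levy_moment4 (\<nu>' n)" for n
      unfolding \<nu>'_def by (rule lm) simp
    have dF: "has_partial_deriv k (F n) (F1 n k)" "has_partial_deriv k (F1 n k) (F2 n k)" for n k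
      unfolding F_def F1_def F2_def by (rule dA1, rule dA2)
    define G1 where "G1 n k = (\<lambda>u. levy_cf (\<nu>' n) (\<alpha>' n) u * levy_moment4.cumulant1 (\<nu>' n) (\<alpha>' n) k u)" for n k
    define G2 where "G2 n k = (\<lambda>u. levy_cf (\<nu>' n) (\<alpha>' n) u *
      ((levy_moment4.cumulant1 (\<nu>' n) (\<alpha>' n) k u)\<^sup>2 + levy_moment4.cumulant2 (\<nu>' n) k u))" for n k
    have dG: "has_partial_deriv k (levy_cf (\<nu>' n) (\<alpha>' n)) (G1 n k)" "has_partial_deriv k (G1 n k) (G2 n k)" for n k
      unfolding G1_def G2_def
      by (rule levy_moment4.has_partial_deriv_levy_cf[OF \<nu>'], rule levy_moment4.has_partial_deriv2_levy_cf[OF \<nu>'])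
    define H1 where "H1 k = (\<lambda>u. levy_cf \<nu> \<alpha> u * \<nu>.cumulant1 \<alpha> k u)" for k
    define H2 where "H2 k = (\<lambda>u. levy_cf \<nu> \<alpha> u * ((\<nu>.cumulant1 \<alpha> k u)\<^sup>2 + \<nu>.cumulant2 k u))" for k
    have dH: "has_partial_deriv k (levy_cf \<nu> \<alpha>) (H1 k)" "has_partial_deriv k (H1 k) (H2 k)" for k
      unfolding H1_def H2_def by (rule \<nu>.has_partial_deriv_levy_cf, rule \<nu>.has_partial_deriv2_levy_cf)
    \<comment> \<open>The derivatives of \<open>levy_cf \<nu> \<alpha>\<close> are represented here
      as expectations under \<open>P\<close>, and later by the cumulants in \<open>H1\<close> and
      \<open>H2\<close>; \<open>dist2\<close> is the same number in both representations.\<close>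
    have lim: "(\<lambda>n. dist2 w (F n) (levy_cf \<nu> \<alpha>)) \<longlonglongrightarrow> 0"
      unfolding E0[symmetric]
    proof (rule dist2_tendsto_0I[where ?f1.0 = F1 and ?f2.0 = F2 and ?g1.0 = "\<lambda>_ k. E (h1 k)" and ?g2.0 = "\<lambda>_ k. E (h2 k)"])
      show "(\<lambda>n. weighted_sup_norm w (\<lambda>u. F n u - E (\<lambda>_. 1) u)) \<longlonglongrightarrow> 0"
        unfolding F_def by (rule LIMSEQ_Suc[OF elim(1)])
      show "(\<lambda>n. weighted_sup_norm w (\<lambda>u. F1 n k u - E (h1 k) u)) \<longlonglongrightarrow> 0" for k
        unfolding F1_def by (rule LIMSEQ_Suc[OF elim(2)[rule_format]])
      show "(\<lambda>n. weighted_sup_norm w (\<lambda>u. F2 n k u - E (h2 k) u)) \<longlonglongrightarrow> 0" for k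
        unfolding F2_def by (rule LIMSEQ_Suc[OF elim(3)[rule_format]])
    qed (rule dF dE1 dE2)+
    have le: "dist2 w (F n) (levy_cf (\<nu>' n) (\<alpha>' n)) \<le> dist2 w (F n) (levy_cf \<nu> \<alpha>) + ennreal (\<delta> (Suc n))" for n
    proof -
      \<comment> \<open>The true parameter is itself a competitor in the infimum, as \<nu> has a
        finite fourth moment.\<close>
      have "(INF (\<nu>', \<alpha>') \<in> {\<nu>'. levy_measure4 \<nu>'} \<times> UNIV. dist2 w (F n) (levy_cf \<nu>' \<alpha>')) \<le> dist2 w (F n) (levy_cf \<nu> \<alpha>)"
        by (rule INF_lower2[of "(\<nu>, \<alpha>)"]) (use \<nu>.levy_measure4 in auto)
      then show ?thesis
        using est[of n] unfolding min_distance_estimate_def emp F_def[symmetric] \<nu>'_def[symmetric] \<alpha>'_def[symmetric]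
        by (meson add_right_mono order_trans)
    qed
    have "(\<lambda>n. dist2 w (F n) (levy_cf \<nu> \<alpha>) + ennreal (\<delta> (Suc n))) \<longlonglongrightarrow> 0 + ennreal 0"
      by (intro tendsto_add lim tendsto_ennrealI LIMSEQ_Suc assms(10))
    then have upper: "(\<lambda>n. dist2 w (F n) (levy_cf \<nu> \<alpha>) + ennreal (\<delta> (Suc n))) \<longlonglongrightarrow> 0"
      by simp
    have lim': "(\<lambda>n. dist2 w (F n) (levy_cf (\<nu>' n) (\<alpha>' n))) \<longlonglongrightarrow> 0"
      by (rule tendsto_sandwich[OF _ _ tendsto_const upper]) (use le in auto)
    \<comment> \<open>In place of a triangle inequality for \<open>dist2\<close>, the empirical
      functions approach both the true and the estimated ones, and the two statements are subtracted
      pointwise.\<close>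
    have comb: "g \<longlonglongrightarrow> b" if "(\<lambda>n. a n - b) \<longlonglongrightarrow> 0" "(\<lambda>n. a n - g n) \<longlonglongrightarrow> 0" for a g :: "nat \<Rightarrow> complex" and b
    proof -
      have "(\<lambda>n. b + ((a n - b) - (a n - g n))) \<longlonglongrightarrow> b + (0 - 0)"
        by (intro tendsto_add tendsto_diff tendsto_const that)
      then show ?thesis by simp
    qed
    note D = dist2_tendsto_0D[where f = F and ?f1.0 = F1 and ?f2.0 = F2 and g = "\<lambda>_. levy_cf \<nu> \<alpha>"
        and ?g1.0 = "\<lambda>_. H1" and ?g2.0 = "\<lambda>_. H2", OF dF dH lim assms(6)]
    note D' = dist2_tendsto_0D[where f = F and ?f1.0 = F1 and ?f2.0 = F2
        and g = "\<lambda>n. levy_cf (\<nu>' n) (\<alpha>' n)" and ?g1.0 = G1 and ?g2.0 = G2, OF dF dG lim' assms(6)]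
    have conv: "(\<lambda>n. levy_cf (\<nu>' n) (\<alpha>' n) u) \<longlonglongrightarrow> levy_cf \<nu> \<alpha> u"
      "(\<lambda>n. G1 n k u) \<longlonglongrightarrow> H1 k u" "(\<lambda>n. G2 n k u) \<longlonglongrightarrow> H2 k u" for k u
      by (rule comb[OF D(1) D'(1)], rule comb[OF D(2) D'(2)], rule comb[OF D(3) D'(3)])
    have "(\<lambda>n. \<integral>x. f x * (norm x)\<^sup>2 \<partial>\<nu>_hat n \<omega>) \<longlonglongrightarrow> (\<integral>x. f x * (norm x)\<^sup>2 \<partial>\<nu>)"
      if "continuous_on UNIV f" "bounded (range f)" for f :: "real ^ 'd \<Rightarrow> real"
    proof -
      have "(\<lambda>n. \<integral>x. f x * (norm x)\<^sup>2 \<partial>\<nu>' n) \<longlonglongrightarrow> (\<integral>x. f x * (norm x)\<^sup>2 \<partial>\<nu>)"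
        by (rule levy_cf_tendsto_imp_weak_convergence[OF \<nu>.levy_moment4_axioms \<nu>'
              conv(1) conv(2)[unfolded G1_def H1_def] conv(3)[unfolded G2_def H2_def] that])
      then show ?thesis
        unfolding \<nu>'_def by (rule LIMSEQ_imp_Suc)
    qed
    then show ?case
      using \<nu>.finite_measure_density levy_moment4.finite_measure_density[OF lm] by blast
  qed
qed

end
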